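(* Let $R$ be a $0$-dimensional affine $K$-algebra over a field $K$, and assume that $K$ is a quasi-perfect field for $R$. Then every element $a\in R$ has a unique decomposition $a=b+r$ with $b\in R^{\mathrm{sep}}$ and $r\in\operatorname{Rad}(0)$. In particular, $R=R^{\mathrm{sep}}\oplus\operatorname{Rad}(0)$ is a decomposition into a direct sum of $K$-vector subspaces.
   Context: Write $R=K[x_1,\dots,x_n]/I$ with $I$ a $0$-dimensional ideal. A polynomial $f\in K[x]$ is separable if it is a non-zero constant or factors over the algebraic closure $\overline K$ into pairwise distinct linear factors. If $f=(x-a_1)^{e_1}\cdots(x-a_r)^{e_r}\in\overline K[x]$ with pairwise distinct $a_i$ and $e_i\ge1$, then $\operatorname{sep}(f)=(x-a_1)\cdots(x-a_r)$. An element of $R$ is separable if its minimal polynomial over $K$ is separable; the set $R^{\mathrm{sep}}$ of all separable elements of $R$ is a $K$-subalgebra of $R$. The zero radical $\operatorname{Rad}(0)$ is the intersection of all maximal ideals of $R$. A $0$-dimensional radical ideal of a polynomial ring over a field is called separable if it remains radical over every extension field. An extension field $L$ of $K$ is a quasi-perfect field for $R$ if the radical of $IL[x_1,\dots,x_n]$ is separable; equivalently, if for all $a\in R$ the minimal polynomial $\mu_a\in K[z]$ satisfies $\operatorname{sep}(\mu_a)\in L[z]$. Here this is assumed for $L=K$. *)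

theory Defs
  imports "HOL-Algebra.Algebra" "HOL-Algebra.Algebraic_Closure_Type"
begin

text \<open>
  The ring \<open>F[x\<^sub>0, \<dots>, x\<^sub>n\<^sub>-\<^sub>1]\<close> on the indexed polynomials of the library, which come without
  a multiplication of two polynomials; it is the convolution of coefficient functions.
\<close>

definition mpoly_ring :: "nat \<Rightarrow> ('a, 'm) ring_scheme \<Rightarrow> (nat multiset \<Rightarrow> 'a) ring" where
  "mpoly_ring n F =
     \<lparr>carrier = ring.indexed_pset F {..<n} (carrier F),
      monoid.mult = (\<lambda>f g m. \<Oplus>\<^bsub>F\<^esub>t\<in>{t. t \<subseteq># m}. f t \<otimes>\<^bsub>F\<^esub> g (m - t)),
      one = ring.indexed_const F \<one>\<^bsub>F\<^esub>,
      ring.zero = ring.indexed_const F \<zero>\<^bsub>F\<^esub>,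
      add = ring.indexed_padd F\<rparr>"

definition radical :: "('a, 'm) ring_scheme \<Rightarrow> 'a set \<Rightarrow> 'a set" where
  "radical P J = {f \<in> carrier P. \<exists>k::nat. f [^]\<^bsub>P\<^esub> k \<in> J}"

definition radical_ideal :: "('a, 'm) ring_scheme \<Rightarrow> 'a set \<Rightarrow> bool" where
  "radical_ideal P J \<longleftrightarrow> ideal J P \<and> radical P J = J"

definition zero_radical :: "('a, 'm) ring_scheme \<Rightarrow> 'a set" where
  "zero_radical R = {x \<in> carrier R. \<forall>M. maximalideal M R \<longrightarrow> x \<in> M}"

definition affine_algebra ::
    "nat \<Rightarrow> ('a, 'm) ring_scheme \<Rightarrow> (nat multiset \<Rightarrow> 'a) set \<Rightarrow> (nat multiset \<Rightarrow> 'a) set ring" where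
  "affine_algebra n F I = mpoly_ring n F Quot I"

definition scalar ::
    "nat \<Rightarrow> ('a, 'm) ring_scheme \<Rightarrow> (nat multiset \<Rightarrow> 'a) set \<Rightarrow> 'a \<Rightarrow> (nat multiset \<Rightarrow> 'a) set" where
  "scalar n F I c = I +>\<^bsub>mpoly_ring n F\<^esub> ring.indexed_const F c"

text \<open>
  A \<open>0\<close>-dimensional ideal is one whose residue class ring is a finite-dimensional vector space; the
  unit ideal is admitted. Scalars act through their residue classes, so the image of \<open>F\<close> in the
  residue class ring is the field of scalars for the library's linear algebra
  (in which \<^const>\<open>subalgebra\<close> means linear subspace).
\<close>

definition zero_dimensional ::
    "nat \<Rightarrow> ('a, 'm) ring_scheme \<Rightarrow> (nat multiset \<Rightarrow> 'a) set \<Rightarrow> bool" where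
  "zero_dimensional n F I \<longleftrightarrow>
     ideal I (mpoly_ring n F) \<and>
     ring.finite_dimension (affine_algebra n F I) (scalar n F I ` carrier F)
       (carrier (affine_algebra n F I))"

text \<open>Field extensions are given by an embedding \<open>h\<close>, so that \<open>L\<close> need not contain \<open>F\<close> as a set.\<close>

definition extension_field :: "('a, 'm) ring_scheme \<Rightarrow> ('b, 'l) ring_scheme \<Rightarrow> ('a \<Rightarrow> 'b) \<Rightarrow> bool" where
  "extension_field F L h \<longleftrightarrow> field F \<and> field L \<and> h \<in> ring_hom F L"

definition extend_ideal ::
    "nat \<Rightarrow> ('b, 'l) ring_scheme \<Rightarrow> ('a \<Rightarrow> 'b) \<Rightarrow> (nat multiset \<Rightarrow> 'a) set \<Rightarrow> (nat multiset \<Rightarrow> 'b) set" where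
  "extend_ideal n L h J = Idl\<^bsub>mpoly_ring n L\<^esub> ((\<lambda>f. h \<circ> f) ` J)"

text \<open>
  HOL cannot quantify over the fields of all types at once. The argument \<open>TYPE('u)\<close> is the
  universe: the extension fields \<open>L\<close> range over all fields whose carrier is a subset of \<open>'u\<close>.
  Shrinking the universe weakens the property. It does not depend on the universe as long as \<open>'u\<close>
  has at least as many elements as an algebraic closure of \<open>F\<close>.
\<close>

definition separable_ideal ::
    "'u itself \<Rightarrow> nat \<Rightarrow> ('a, 'm) ring_scheme \<Rightarrow> (nat multiset \<Rightarrow> 'a) set \<Rightarrow> bool" where
  "separable_ideal _ n F J \<longleftrightarrow>
     zero_dimensional n F J \<and> radical_ideal (mpoly_ring n F) J \<and>
     (\<forall>(L :: 'u ring) h. extension_field F L h \<longrightarrow>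
        radical_ideal (mpoly_ring n L) (extend_ideal n L h J))"

definition quasi_perfect_field ::
    "'u itself \<Rightarrow> nat \<Rightarrow> ('a, 'm) ring_scheme \<Rightarrow> (nat multiset \<Rightarrow> 'a) set \<Rightarrow>
     ('b, 'l) ring_scheme \<Rightarrow> ('a \<Rightarrow> 'b) \<Rightarrow> bool" where
  "quasi_perfect_field U n F I L h \<longleftrightarrow>
     extension_field F L h \<and>
     separable_ideal U n L (radical (mpoly_ring n L) (extend_ideal n L h I))"

text \<open>
  From here on the base field is a type \<open>'k\<close> of class \<open>field\<close>, viewed as a ring record by
  \<^const>\<open>ring_of_type_algebra\<close>; its algebraic closure is the type \<open>'k alg_closure\<close>.
\<close>

text \<open>The empty set of roots yields the non-zero constants.\<close>

definition separable_poly :: "'k::field poly \<Rightarrow> bool" where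
  "separable_poly f \<longleftrightarrow>
     (\<exists>c A. c \<noteq> 0 \<and> finite A \<and> map_poly to_ac f = Polynomial.smult c (\<Prod>a\<in>A. [:- a, 1:]))"

definition eval_at ::
    "nat \<Rightarrow> (nat multiset \<Rightarrow> 'k) set \<Rightarrow> (nat multiset \<Rightarrow> 'k) set \<Rightarrow> 'k::field poly \<Rightarrow>
     (nat multiset \<Rightarrow> 'k) set" where
  "eval_at n I a f =
     (let R = affine_algebra n ring_of_type_algebra I in
      \<Oplus>\<^bsub>R\<^esub>i\<in>{..Polynomial.degree f}.
        scalar n ring_of_type_algebra I (Polynomial.coeff f i) \<otimes>\<^bsub>R\<^esub> a [^]\<^bsub>R\<^esub> i)"

text \<open>The monic generator of the kernel of \<open>K[z] \<rightarrow> R, z \<mapsto> a\<close>.\<close>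

definition min_poly ::
    "nat \<Rightarrow> (nat multiset \<Rightarrow> 'k) set \<Rightarrow> (nat multiset \<Rightarrow> 'k) set \<Rightarrow> 'k::field poly" where
  "min_poly n I a =
     (THE f. Polynomial.lead_coeff f = 1 \<and>
        (\<forall>g. eval_at n I a g = \<zero>\<^bsub>affine_algebra n ring_of_type_algebra I\<^esub> \<longleftrightarrow> f dvd g))"

definition separable_elements ::
    "nat \<Rightarrow> (nat multiset \<Rightarrow> 'k::field) set \<Rightarrow> (nat multiset \<Rightarrow> 'k) set set" where
  "separable_elements n I =
     {a \<in> carrier (affine_algebra n ring_of_type_algebra I). separable_poly (min_poly n I a)}"

end

theory Submission
  imports Defs "HOL-Library.Poly_Mapping"
begin

text \<open>
  Write \<open>J\<close> for the radical of \<open>I\<close>. As \<open>R\<close> is algebraic over \<open>K\<close>, the zero radical of \<open>R\<close> is its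
  nilradical, the image of \<open>J\<close> (\<open>zero_radical_eq\<close>).

  Existence. Let \<open>\<nu>\<close> be the minimal polynomial of \<open>a\<close> modulo \<open>J\<close>, and let \<open>g\<close> be the product of the
  distinct linear factors of \<open>\<nu>\<close> over the algebraic closure of \<open>K\<close>. A power of \<open>g\<close> is a multiple of
  \<open>\<nu>\<close>, so a power of \<open>g(a)\<close> lies in the extension of \<open>J\<close> to the closure. By quasi-perfectness this
  extension is still radical, hence it contains \<open>g(a)\<close>. A minimal polynomial does not change under
  extension of the base field (\<open>minimal_polynomial_base_change\<close>), so \<open>\<nu>\<close> divides \<open>g\<close> and \<open>\<nu>\<close> is
  separable (\<open>separable_minimal_polynomial\<close>). Now \<open>\<nu>(a)\<close> is nilpotent in \<open>R\<close> and \<open>\<nu>'\<close> is invertible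
  modulo \<open>\<nu>\<close>; Newton iteration therefore changes \<open>a\<close> by a nilpotent element into an exact root \<open>b\<close>
  of \<open>\<nu>\<close> (\<open>newton_lift\<close>, \<open>separable_lift\<close>), and \<open>b\<close> is separable because its minimal polynomial
  divides \<open>\<nu>\<close>.

  Uniqueness. Two decompositions differ by an element that is a difference of separable elements
  and also nilpotent. Separable elements form a subspace: over the closure, separable elements
  \<open>b\<close> and \<open>b'\<close> behave like commuting diagonalisable operators with finite sets \<open>A\<close> and \<open>B\<close> of
  eigenvalues, so that \<open>c b + d b'\<close> is a root of the product of the distinct \<open>z - (c \<alpha> + d \<beta>)\<close>
  (\<open>split_linear_combination\<close>). Finally, a separable nilpotent element is \<open>0\<close>, since \<open>0\<close> is at
  most a simple root of its minimal polynomial (\<open>separable_nilpotent_in_ideal\<close>).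

  These arguments take place in polynomial rings modulo ideals. They are carried out on the type of
  finitely supported functions \<open>nat multiset \<Rightarrow>\<^sub>0 'k\<close>, which is a commutative ring in the sense
  of the type classes, and are transported to the ring records and their residue classes.
\<close>

section \<open>Polynomials in one variable over a field\<close>

text \<open>
  The usual argument by division with remainder. It supplies minimal polynomials as well as Bezout
  identities over an arbitrary field.
\<close>

lemma polynomial_ideal_generator:
  fixes S :: "'k::field poly set"
  assumes add: "\<And>f g. f \<in> S \<Longrightarrow> g \<in> S \<Longrightarrow> f + g \<in> S"
    and mult: "\<And>f g. g \<in> S \<Longrightarrow> f * g \<in> S"
    and nonzero: "f \<in> S" "f \<noteq> 0"
  obtains m where "lead_coeff m = 1" "\<And>g. g \<in> S \<longleftrightarrow> m dvd g"
proof -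
  obtain h where h: "h \<in> S" "h \<noteq> 0"
    and least: "\<And>g. g \<in> S \<Longrightarrow> g \<noteq> 0 \<Longrightarrow> Polynomial.degree h \<le> Polynomial.degree g"
    using ex_has_least_nat[of "\<lambda>g. g \<in> S \<and> g \<noteq> 0" f Polynomial.degree] nonzero by blast
  define m where "m = Polynomial.smult (inverse (lead_coeff h)) h"
  have "lead_coeff m = 1"
    using h(2) by (simp add: m_def)
  moreover have "g \<in> S \<longleftrightarrow> m dvd g" for g
  proof
    assume "g \<in> S"
    have "g mod h = g + - (g div h) * h"
      by (simp add: minus_div_mult_eq_mod)
    then have "g mod h \<in> S"
      using add[OF \<open>g \<in> S\<close> mult[OF h(1), of "- (g div h)"]] by (simp only:)
    then have "g mod h = 0"
      using least degree_mod_less[OF h(2), of g] by force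
    then show "m dvd g"
      using h(2) by (simp add: m_def smult_dvd_iff mod_eq_0_iff_dvd)
  next
    assume "m dvd g"
    then have "h dvd g"
      using h(2) by (simp add: m_def smult_dvd_iff)
    then show "g \<in> S"
      using mult[OF h(1)] by (auto simp: dvd_def mult.commute)
  qed
  ultimately show thesis
    using that by blast
qed

lemma map_poly_to_ac_add: "map_poly to_ac (f + g) = map_poly to_ac f + map_poly to_ac g"
  by (rule poly_eqI) (simp add: coeff_map_poly)

lemma map_poly_to_ac_smult: "map_poly to_ac (Polynomial.smult c f) = Polynomial.smult (to_ac c) (map_poly to_ac f)"
  by (rule poly_eqI) (simp add: coeff_map_poly)

lemma map_poly_to_ac_mult: "map_poly to_ac (f * g) = map_poly to_ac f * map_poly to_ac g"
  by (induction f)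
    (simp_all add: map_poly_pCons map_poly_to_ac_add map_poly_to_ac_smult)

lemma map_poly_to_ac_pderiv: "map_poly to_ac (pderiv f) = pderiv (map_poly to_ac f)"
  by (rule poly_eqI) (simp add: coeff_map_poly coeff_pderiv del: of_nat_Suc)

lemma degree_map_poly_to_ac: "Polynomial.degree (map_poly to_ac f) = Polynomial.degree f"
  by (cases "f = 0") (auto intro: map_poly_degree_eq)

lemma map_poly_to_ac_eq_0_iff: "map_poly to_ac f = 0 \<longleftrightarrow> f = 0"
  by (auto simp: map_poly_eq_0_iff)

text \<open>
  Unique factorization, for a product of distinct linear factors: each root of \<open>h\<close> splits off from
  both sides, and a linear factor that does not divide \<open>h\<close> may be dropped from the product.
\<close>

lemma divisor_of_distinct_linear_factors:
  fixes h :: "'a::field poly"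
  assumes "finite A" "h dvd (\<Prod>a\<in>A. [:- a, 1:])"
  shows "\<exists>d B. d \<noteq> 0 \<and> finite B \<and> h = Polynomial.smult d (\<Prod>a\<in>B. [:- a, 1:])"
  using assms
proof (induction A arbitrary: h)
  case empty
  then have "h dvd 1"
    by simp
  then obtain d where d: "h = [:d:]"
    using is_unit_poly_iff by blast
  with \<open>h dvd 1\<close> have "d \<noteq> 0"
    by auto
  with d show ?case
    by (intro exI[of _ d] exI[of _ "{}"]) simp
next
  case (insert a A)
  show ?case
  proof (cases "[:- a, 1:] dvd h")
    case True
    then obtain h' where h: "h = [:- a, 1:] * h'" ..
    have "[:- a, 1:] * h' dvd [:- a, 1:] * (\<Prod>a\<in>A. [:- a, 1:])"
      using insert.prems unfolding h prod.insert[OF insert.hyps] .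
    then have dvd: "h' dvd (\<Prod>a\<in>A. [:- a, 1:])"
      by (subst (asm) dvd_mult_cancel_left) simp
    then obtain d B where B: "d \<noteq> 0" "finite B" "h' = Polynomial.smult d (\<Prod>a\<in>B. [:- a, 1:])"
      using insert.IH by blast
    have "a \<notin> B"
    proof
      assume "a \<in> B"
      then have "poly h' a = 0"
        using B by (auto simp: poly_prod)
      then have "poly (\<Prod>a\<in>A. [:- a, 1:]) a = 0"
        using dvd by (metis dvdE mult_eq_0_iff poly_mult)
      then show False
        using insert.hyps by (auto simp: poly_prod)
    qed
    then show ?thesis
      using B by (intro exI[of _ d] exI[of _ "insert a B"]) (simp add: h)
  next
    case False
    obtain q where q: "[:- a, 1:] * (\<Prod>a\<in>A. [:- a, 1:]) = h * q"
      using insert.prems insert.hyps by (auto simp: dvd_def)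
    have "poly (h * q) a = 0"
      unfolding q[symmetric] by simp
    moreover have "poly h a \<noteq> 0"
      using False by (simp add: poly_eq_0_iff_dvd)
    ultimately have "[:- a, 1:] dvd q"
      by (simp add: poly_eq_0_iff_dvd)
    then obtain q' where "q = [:- a, 1:] * q'" ..
    then have "[:- a, 1:] * (\<Prod>a\<in>A. [:- a, 1:]) = [:- a, 1:] * (h * q')"
      using q by (simp only: mult.left_commute[of h])
    then have "(\<Prod>a\<in>A. [:- a, 1:]) = h * q'"
      by (subst (asm) mult_cancel_left) simp
    then show ?thesis
      using insert.IH by simp
  qed
qed

lemma separable_poly_if_dvd_distinct_linear_factors:
  assumes "finite A" "map_poly to_ac f dvd (\<Prod>a\<in>A. [:- a, 1:])"
  shows "separable_poly f"
  using divisor_of_distinct_linear_factors[OF assms] by (auto simp: separable_poly_def)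

lemma separable_poly_divisor:
  assumes "separable_poly g" "f dvd g"
  shows "separable_poly f"
proof -
  obtain c A where A: "c \<noteq> 0" "finite A" "map_poly to_ac g = Polynomial.smult c (\<Prod>a\<in>A. [:- a, 1:])"
    using assms(1) by (auto simp: separable_poly_def)
  have "map_poly to_ac f dvd Polynomial.smult c (\<Prod>a\<in>A. [:- a, 1:])"
    using assms(2) by (auto simp: dvd_def map_poly_to_ac_mult simp flip: A(3))
  then show ?thesis
    using A by (intro separable_poly_if_dvd_distinct_linear_factors[of A]) (simp_all add: dvd_smult_iff)
qed

text \<open>
  A common factor of \<open>f\<close> and its derivative would have a root in the algebraic closure, but the
  derivative does not vanish at a simple root.
\<close>

lemma separable_poly_bezout_pderiv:
  fixes f :: "'k::field poly"
  assumes "separable_poly f"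
  obtains u v where "u * f + v * pderiv f = 1"
proof -
  obtain c A where A: "c \<noteq> 0" "finite A" "map_poly to_ac f = Polynomial.smult c (\<Prod>a\<in>A. [:- a, 1:])"
    using assms by (auto simp: separable_poly_def)
  define S where "S = {u * f + v * pderiv f |u v. True}"
  have combination: "u * f + v * pderiv f \<in> S" for u v
    unfolding S_def by blast
  have "f \<in> S" "pderiv f \<in> S"
    using combination[of 1 0] combination[of 0 1] by simp_all
  have "f \<noteq> 0"
    using A by auto
  have "g + h \<in> S" if S: "g \<in> S" "h \<in> S" for g h
  proof -
    obtain u v u' v' where "g = u * f + v * pderiv f" "h = u' * f + v' * pderiv f"
      using S unfolding S_def by blast
    then have "g + h = (u + u') * f + (v + v') * pderiv f"
      by (simp add: algebra_simps)
    then show ?thesis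
      using combination by simp
  qed
  moreover have "g * h \<in> S" if S: "h \<in> S" for g h
  proof -
    obtain u v where "h = u * f + v * pderiv f"
      using S by (auto simp: S_def)
    then have "g * h = (g * u) * f + (g * v) * pderiv f"
      by (simp add: algebra_simps)
    then show ?thesis
      using combination by simp
  qed
  ultimately obtain d where d: "lead_coeff d = 1" "\<And>g. g \<in> S \<longleftrightarrow> d dvd g"
    using polynomial_ideal_generator[of S f] \<open>f \<in> S\<close> \<open>f \<noteq> 0\<close> by blast
  have "Polynomial.degree d = 0"
  proof (rule ccontr)
    assume "Polynomial.degree d \<noteq> 0"
    then obtain x where x: "poly (map_poly to_ac d) x = 0"
      using alg_closed_imp_poly_has_root[of "map_poly to_ac d"] by (auto simp: degree_map_poly_to_ac)
    have root: "poly (map_poly to_ac g) x = 0" if "g \<in> S" for g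
      using that x by (auto simp: d(2) dvd_def map_poly_to_ac_mult)
    have "poly (map_poly to_ac f) x = 0"
      using root \<open>f \<in> S\<close> by blast
    then have "x \<in> A"
      using A by (auto simp: poly_prod)
    define g where "g = Polynomial.smult c (\<Prod>a\<in>A - {x}. [:- a, 1:])"
    have "map_poly to_ac f = [:- x, 1:] * g"
      unfolding A(3) g_def prod.remove[OF A(2) \<open>x \<in> A\<close>] by (rule mult_smult_right[symmetric])
    then have "poly (pderiv (map_poly to_ac f)) x = poly g x"
      by (simp add: pderiv_mult pderiv_pCons del: mult_pCons_left)
    moreover have "poly g x \<noteq> 0"
      using A by (auto simp: g_def poly_prod)
    ultimately show False
      using root[OF \<open>pderiv f \<in> S\<close>] by (simp add: map_poly_to_ac_pderiv)
  qed
  then have "d = 1"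
    using d(1) by (auto elim!: degree_eq_zeroE simp: one_pCons)
  then have "1 \<in> S"
    by (simp add: d(2))
  then show thesis
    using that by (auto simp: S_def)
qed

lemma pcompose_taylor:
  fixes f p h :: "'k::idom poly"
  obtains s where "pcompose f (p + h) = pcompose f p + pcompose (pderiv f) p * h + h\<^sup>2 * s"
proof -
  have "\<exists>s. pcompose f (p + h) = pcompose f p + pcompose (pderiv f) p * h + h\<^sup>2 * s"
  proof (induction f)
    case 0
    then show ?case
      by auto
  next
    case (pCons a f)
    then obtain s where s: "pcompose f (p + h) = pcompose f p + pcompose (pderiv f) p * h + h\<^sup>2 * s"
      by blast
    have "pcompose (pderiv (pCons a f)) p = pcompose f p + p * pcompose (pderiv f) p"
      by (simp add: pderiv_pCons pcompose_add pcompose_pCons)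
    moreover have "c + (p + h) * (g + d * h + h\<^sup>2 * s) =
        (c + p * g) + (g + p * d) * h + h\<^sup>2 * (d + (p + h) * s)" for c g d :: "'k poly"
      by (simp add: algebra_simps power2_eq_square)
    ultimately have "pcompose (pCons a f) (p + h) =
        pcompose (pCons a f) p + pcompose (pderiv (pCons a f)) p * h +
        h\<^sup>2 * (pcompose (pderiv f) p + (p + h) * s)"
      by (simp only: pcompose_pCons s)
    then show ?case
      by blast
  qed
  then show thesis
    using that by blast
qed

text \<open>
  Newton iteration, performed on polynomials so that it applies to every ring element at once: if
  \<open>f(a)\<close> is nilpotent, then \<open>p(a)\<close> is a root of \<open>f\<close> that differs from \<open>a\<close> by a multiple of \<open>f(a)\<close>.
  The Bezout coefficient \<open>v\<close> plays the part of \<open>1 / f'\<close>.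
\<close>

lemma newton_lift:
  fixes f :: "'k::field poly"
  assumes "u * f + v * pderiv f = 1"
  shows "\<exists>p. f ^ Suc j dvd pcompose f p \<and> f dvd p - [:0, 1:]"
proof (induction j)
  case 0
  then show ?case
    by (intro exI[of _ "[:0, 1:]"]) simp
next
  case (Suc j)
  then obtain p where p: "f ^ Suc j dvd pcompose f p" "f dvd p - [:0, 1:]"
    by blast
  define w where "w = pcompose f p"
  \<comment> \<open>the Newton step: the first order term of \<open>f (p + h)\<close> cancels \<open>w\<close> up to a multiple of \<open>w\<^sup>2\<close>\<close>
  define h where "h = - (pcompose v p * w)"
  obtain s where s: "pcompose f (p + h) = w + pcompose (pderiv f) p * h + h\<^sup>2 * s"
    using pcompose_taylor[of f p h] unfolding w_def by blast
  have bezout: "pcompose u p * w + pcompose v p * pcompose (pderiv f) p = 1"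
    using arg_cong[OF assms, of "\<lambda>g. pcompose g p"]
    by (simp add: pcompose_add pcompose_mult pcompose_1 w_def)
  have "w + d * - (b * w) + (- (b * w))\<^sup>2 * s = w * w * (a + b\<^sup>2 * s)"
    if "a * w + b * d = 1" for a b d :: "'k poly"
  proof -
    have "w + d * - (b * w) + (- (b * w))\<^sup>2 * s = w * (1 - b * d) + w * w * (b\<^sup>2 * s)"
      by (simp add: algebra_simps power2_eq_square)
    also have "1 - b * d = a * w"
      using that by (simp only: diff_eq_eq)
    finally show ?thesis
      by (simp add: algebra_simps)
  qed
  from this[OF bezout] have "pcompose f (p + h) = w * w * (pcompose u p + (pcompose v p)\<^sup>2 * s)"
    unfolding s by (simp only: h_def)
  moreover have "f ^ Suc (Suc j) dvd w * w"
  proof -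
    have "f ^ Suc (Suc j) dvd f ^ (Suc j + Suc j)"
      by (rule le_imp_power_dvd) simp
    also have "\<dots> dvd w * w"
      unfolding power_add using p(1) by (intro mult_dvd_mono) (simp_all add: w_def)
    finally show ?thesis .
  qed
  ultimately have "f ^ Suc (Suc j) dvd pcompose f (p + h)"
    by (metis dvd_mult2)
  moreover have "f dvd p + h - [:0, 1:]"
  proof -
    have "f dvd w"
      using p(1) dvd_trans[OF dvd_power[of "Suc j" f]] by (simp add: w_def)
    then have "f dvd (p - [:0, 1:]) + h"
      using p(2) by (intro dvd_add) (simp_all add: h_def)
    then show ?thesis
      by (simp add: algebra_simps)
  qed
  ultimately show ?case
    by blast
qed

section \<open>Polynomial expressions modulo an ideal\<close>

text \<open>
  Evaluation in an algebra whose structure map is \<open>C\<close>.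
\<close>

definition ev :: "('k::field \<Rightarrow> 'a::comm_ring_1) \<Rightarrow> 'k poly \<Rightarrow> 'a \<Rightarrow> 'a" where
  "ev C f p = poly (map_poly C f) p"

text \<open>
  The residue class algebra \<open>P / I\<close> enters only through the congruence modulo \<open>I\<close>. The algebra is
  given as a subset \<open>P\<close> of a type because the number of variables is not fixed by the type of
  polynomials.
\<close>

locale algebra_ideal =
  fixes C :: "'k::field \<Rightarrow> 'a::comm_ring_1" and P I :: "'a set"
  assumes C_0: "C 0 = 0" and C_1: "C 1 = 1"
    and C_add: "C (c + d) = C c + C d" and C_mult: "C (c * d) = C c * C d"
    and C_closed: "C c \<in> P"
    and P_add: "p \<in> P \<Longrightarrow> q \<in> P \<Longrightarrow> p + q \<in> P"
    and P_mult: "p \<in> P \<Longrightarrow> q \<in> P \<Longrightarrow> p * q \<in> P"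
    and I_subset: "I \<subseteq> P"
    and I_zero: "0 \<in> I"
    and I_add: "x \<in> I \<Longrightarrow> y \<in> I \<Longrightarrow> x + y \<in> I"
    and I_mult: "p \<in> P \<Longrightarrow> x \<in> I \<Longrightarrow> p * x \<in> I"
begin

lemma I_mult_right: "x \<in> I \<Longrightarrow> p \<in> P \<Longrightarrow> x * p \<in> I"
  using I_mult by (simp add: mult.commute)

lemma C_minus_1: "C (- 1) = - 1"
proof -
  have "1 + C (- 1) = 0"
    using C_add[of 1 "- 1"] by (simp add: C_0 C_1)
  then show ?thesis
    by (simp add: add_eq_0_iff)
qed

lemma C_uminus: "C (- c) = - C c"
  using C_mult[of "- 1" c] by (simp add: C_minus_1)

lemma P_uminus: "p \<in> P \<Longrightarrow> - p \<in> P"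
  using P_mult[OF C_closed[of "- 1"]] by (simp add: C_minus_1)

lemma P_diff: "p \<in> P \<Longrightarrow> q \<in> P \<Longrightarrow> p - q \<in> P"
  using P_add[OF _ P_uminus] by simp

lemma P_zero: "0 \<in> P" and P_one: "1 \<in> P"
  using C_closed[of 0] C_closed[of 1] by (simp_all add: C_0 C_1)

lemma P_power: "p \<in> P \<Longrightarrow> p ^ k \<in> P"
  by (induction k) (simp_all add: P_one P_mult)

lemma I_uminus: "x \<in> I \<Longrightarrow> - x \<in> I"
  using I_mult[OF C_closed[of "- 1"]] by (simp add: C_minus_1)

lemma I_diff: "x \<in> I \<Longrightarrow> y \<in> I \<Longrightarrow> x - y \<in> I"
  using I_add[OF _ I_uminus] by simp

lemma I_cancel_scalar:
  assumes "C c * x \<in> I" "c \<noteq> 0"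
  shows "x \<in> I"
proof -
  have "C (inverse c) * (C c * x) \<in> I"
    by (rule I_mult[OF C_closed assms(1)])
  also have "C (inverse c) * (C c * x) = x"
    using assms(2) by (simp add: C_1 flip: mult.assoc C_mult)
  finally show ?thesis .
qed

lemma ev_0: "ev C 0 p = 0"
  by (simp add: ev_def)

lemma ev_pCons: "ev C (pCons c f) p = C c + p * ev C f p"
  by (simp add: ev_def map_poly_pCons C_0)

lemma ev_1: "ev C 1 p = 1"
  by (simp add: one_pCons ev_pCons ev_0 C_1)

lemma ev_linear: "ev C [:- a, 1:] p = p - C a"
  by (simp add: ev_pCons ev_0 C_1 C_uminus)

lemma ev_add: "ev C (f + g) p = ev C f p + ev C g p"
proof -
  have "map_poly C (f + g) = map_poly C f + map_poly C g"
    by (rule poly_eqI) (simp add: coeff_map_poly C_0 C_add)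
  then show ?thesis
    by (simp add: ev_def)
qed

lemma ev_smult: "ev C (Polynomial.smult c f) p = C c * ev C f p"
  by (simp add: ev_def map_poly_smult C_0 C_mult)

lemma ev_mult: "ev C (f * g) p = ev C f p * ev C g p"
  by (induction f) (simp_all add: ev_0 ev_pCons ev_add ev_smult algebra_simps C_0)

lemma ev_diff: "ev C (f - g) p = ev C f p - ev C g p"
  using ev_add[of "f - g" g p] by (simp add: algebra_simps)

lemma ev_power: "ev C (f ^ k) p = ev C f p ^ k"
  by (induction k) (simp_all add: ev_1 ev_mult)

lemma ev_pcompose: "ev C (pcompose f g) p = ev C f (ev C g p)"
  by (induction f) (simp_all add: ev_0 ev_pCons pcompose_pCons ev_add ev_mult)

lemma ev_closed: "p \<in> P \<Longrightarrow> ev C f p \<in> P"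
  by (induction f) (simp_all add: ev_0 ev_pCons P_zero P_add P_mult C_closed)

lemma ev_dvd_closed:
  assumes "p \<in> P" "f dvd g" "ev C f p \<in> I"
  shows "ev C g p \<in> I"
  using assms by (auto simp: ev_mult intro!: I_mult_right ev_closed)

lemma minimal_polynomial_exists:
  assumes "p \<in> P" "ev C f p \<in> I" "f \<noteq> 0"
  obtains m where "lead_coeff m = 1" "\<And>g. ev C g p \<in> I \<longleftrightarrow> m dvd g"
proof -
  obtain m where "lead_coeff m = 1" "\<And>g. g \<in> {g. ev C g p \<in> I} \<longleftrightarrow> m dvd g"
    using polynomial_ideal_generator[of "{g. ev C g p \<in> I}" f] assms
    by (auto simp: ev_add ev_mult I_add I_mult ev_closed)
  then show thesis
    using that by simp
qed

text \<open>
  Since \<open>g\<close> is separable, its coefficients \<open>c\<close> and \<open>d\<close> of degrees \<open>0\<close> and \<open>1\<close> do not both vanish. If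
  \<open>p ^ (k + 2)\<close> vanishes modulo \<open>I\<close>, then \<open>p ^ (k + 1) g(p)\<close> is \<open>c p ^ (k + 1)\<close>, and if \<open>c = 0\<close>, then
  \<open>p ^ k g(p)\<close> is \<open>d p ^ (k + 1)\<close>. So the exponent can be lowered to \<open>1\<close>.
\<close>

lemma separable_nilpotent_in_ideal:
  assumes "p \<in> P" "separable_poly g" "ev C g p \<in> I" "p ^ k \<in> I"
  shows "p \<in> I"
proof -
  obtain u v where bezout: "u * g + v * pderiv g = 1"
    using separable_poly_bezout_pderiv[OF assms(2)] .
  obtain c d h where g: "g = pCons c (pCons d h)"
    by (metis pCons_cases)
  have cd: "c \<noteq> 0 \<or> d \<noteq> 0"
    using arg_cong[OF bezout, of "\<lambda>f. poly f 0"] by (auto simp: g pderiv_pCons)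
  have descend: "p ^ Suc k \<in> I" if "p ^ Suc (Suc k) \<in> I" for k
  proof (cases "c = 0")
    case True
    have "p ^ k * ev C g p - p ^ Suc (Suc k) * ev C h p \<in> I"
      using assms that by (intro I_diff I_mult I_mult_right P_power ev_closed)
    also have "p ^ k * ev C g p - p ^ Suc (Suc k) * ev C h p = C d * p ^ Suc k"
      by (simp add: g True ev_pCons C_0 algebra_simps)
    finally show ?thesis
      using I_cancel_scalar cd True by blast
  next
    case False
    have "p ^ Suc k * ev C g p - p ^ Suc (Suc k) * (C d + p * ev C h p) \<in> I"
      using assms that by (intro I_diff I_mult I_mult_right P_power P_add P_mult C_closed ev_closed)
    also have "p ^ Suc k * ev C g p - p ^ Suc (Suc k) * (C d + p * ev C h p) = C c * p ^ Suc k"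
      by (simp add: g ev_pCons algebra_simps)
    finally show ?thesis
      using I_cancel_scalar False by blast
  qed
  have "p ^ Suc k \<in> I"
    using assms by (simp add: I_mult)
  then show ?thesis
  proof (induction k)
    case 0
    then show ?case
      by simp
  qed (use descend in blast)
qed

lemma separable_lift:
  assumes "p \<in> P" "separable_poly f" "ev C f p ^ k \<in> I"
  obtains q where "q \<in> P" "ev C f q \<in> I" "(p - q) ^ k \<in> I"
proof -
  obtain u v where bezout: "u * f + v * pderiv f = 1"
    using separable_poly_bezout_pderiv[OF assms(2)] .
  obtain r where r: "f ^ Suc k dvd pcompose f r" "f dvd r - [:0, 1:]"
    using newton_lift[OF bezout, of k] by blast
  define q where "q = ev C r p"
  have "q \<in> P"
    using assms(1) by (simp add: q_def ev_closed)
  have "ev C (f ^ Suc k) p \<in> I"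
    using assms by (simp add: ev_mult ev_power I_mult ev_closed)
  then have "ev C f q \<in> I"
    using ev_dvd_closed[OF assms(1) r(1)] by (simp add: q_def ev_pcompose)
  obtain s where s: "r - [:0, 1:] = f * s"
    using r(2) ..
  have "q - p = ev C f p * ev C s p"
    using arg_cong[OF s, of "\<lambda>f. ev C f p"]
    by (simp add: q_def ev_mult ev_diff ev_pCons ev_0 C_0 C_1)
  then have difference: "p - q = ev C f p * - ev C s p"
    by (simp add: algebra_simps)
  have "(p - q) ^ k \<in> I"
    unfolding difference power_mult_distrib
    using assms by (intro I_mult_right P_power P_uminus ev_closed)
  with \<open>q \<in> P\<close> \<open>ev C f q \<in> I\<close> show thesis
    by (rule that)
qed

text \<open>
  Reduction to eigenvectors. If a product of distinct factors \<open>x - a\<close> annihilates \<open>w\<close> modulo \<open>I\<close>, then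
  \<open>w\<close> is a sum of multiples of \<open>w\<close> that are annihilated by a single factor each; so \<open>t\<close> annihilates \<open>w\<close>
  as soon as it annihilates all eigenvectors. The set \<open>W\<close> of admissible vectors allows the lemma to
  be applied to two elements in turn, first to \<open>x\<close> and then to \<open>y\<close> on an eigenspace of \<open>x\<close>.
\<close>

lemma annihilator_root_cases:
  assumes "finite A" "x \<in> P" "t \<in> P"
    and W: "\<And>p w. p \<in> P \<Longrightarrow> w \<in> W \<Longrightarrow> p * w \<in> W"
    and roots: "\<And>a w. a \<in> A \<Longrightarrow> w \<in> W \<Longrightarrow> (x - C a) * w \<in> I \<Longrightarrow> t * w \<in> I"
    and "w \<in> W" "ev C (\<Prod>a\<in>A. [:- a, 1:]) x * w \<in> I"
  shows "t * w \<in> I"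
  using assms(1) roots assms(6,7)
proof (induction A arbitrary: w)
  case empty
  then show ?case
    using I_mult[OF assms(3)] by (simp add: ev_1)
next
  case (insert a A)
  define g where "g = (\<Prod>a\<in>A. [:- a, 1:])"
  have "poly g a \<noteq> 0"
    using insert.hyps by (auto simp: g_def poly_prod)
  have "[:- a, 1:] dvd g - [:poly g a:]"
    by (simp flip: poly_eq_0_iff_dvd)
  then obtain h where h: "g - [:poly g a:] = [:- a, 1:] * h" ..
  \<comment> \<open>as \<open>g(a) \<noteq> 0\<close>, this identity is a Bezout relation between \<open>x - a\<close> and \<open>g(x)\<close>\<close>
  have split: "ev C g x - C (poly g a) = (x - C a) * ev C h x"
    using arg_cong[OF h, of "\<lambda>f. ev C f x"]
    by (simp only: ev_mult ev_diff ev_linear) (simp add: ev_pCons ev_0)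
  have in_I: "(x - C a) * (ev C g x * w) \<in> I"
    using insert.prems(3) insert.hyps
    by (simp only: prod.insert[OF insert.hyps] ev_mult ev_linear mult.assoc flip: g_def)
  have "t * (ev C g x * w) \<in> I"
    using insert.prems(1)[of a "ev C g x * w"] in_I W insert.prems(2) assms(2) by (simp add: ev_closed)
  moreover have "t * ((x - C a) * ev C h x * w) \<in> I"
  proof (rule insert.IH)
    show "(x - C a) * ev C h x * w \<in> W"
      using assms(2) insert.prems(2) by (intro W P_mult P_diff ev_closed C_closed)
    have "ev C h x * ((x - C a) * (ev C g x * w)) \<in> I"
      by (rule I_mult[OF ev_closed[OF assms(2)] in_I])
    then show "ev C (\<Prod>a\<in>A. [:- a, 1:]) x * ((x - C a) * ev C h x * w) \<in> I"
      by (simp add: mult_ac flip: g_def)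
  qed (use insert.prems in blast)
  ultimately have "t * (ev C g x * w) - t * ((x - C a) * ev C h x * w) \<in> I"
    by (rule I_diff)
  also have "t * (ev C g x * w) - t * ((x - C a) * ev C h x * w) = C (poly g a) * (t * w)"
    unfolding split[symmetric] by (simp add: algebra_simps)
  finally show ?case
    using I_cancel_scalar \<open>poly g a \<noteq> 0\<close> by blast
qed

text \<open>
  On a common eigenvector of \<open>x\<close> and \<open>y\<close> with eigenvalues \<open>a\<close> and \<open>b\<close> the linear combination acts as
  \<open>c a + d b\<close>, and the vector \<open>1\<close> decomposes into common eigenvectors. Taking the image as a set
  removes coinciding values, so that the factors of the resulting product are distinct.
\<close>

lemma split_linear_combination:
  assumes "finite A" "finite B" "x \<in> P" "y \<in> P"
    and "ev C (\<Prod>a\<in>A. [:- a, 1:]) x \<in> I" "ev C (\<Prod>b\<in>B. [:- b, 1:]) y \<in> I"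
  shows "ev C (\<Prod>e\<in>(\<lambda>(a, b). c * a + d * b) ` (A \<times> B). [:- e, 1:]) (C c * x + C d * y) \<in> I"
proof -
  define E where "E = (\<lambda>(a, b). c * a + d * b) ` (A \<times> B)"
  define z where "z = C c * x + C d * y"
  define t where "t = ev C (\<Prod>e\<in>E. [:- e, 1:]) z"
  have "z \<in> P"
    using assms(3,4) by (simp add: z_def P_add P_mult C_closed)
  then have "t \<in> P"
    by (simp add: t_def ev_closed)
  have both_roots: "t * w \<in> I"
    if ab: "a \<in> A" "b \<in> B" and w: "w \<in> P" "(x - C a) * w \<in> I" "(y - C b) * w \<in> I" for a b w
  proof -
    define e where "e = c * a + d * b"
    have "e \<in> E" "finite E"
      using ab assms(1,2) by (auto simp: E_def e_def)
    then have "(\<Prod>e\<in>E. [:- e, 1:]) = (\<Prod>e\<in>E - {e}. [:- e, 1:]) * [:- e, 1:]"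
      by (simp only: prod.remove[of E e] mult.commute)
    then have "t * w = ev C (\<Prod>e\<in>E - {e}. [:- e, 1:]) z * ((z - C e) * w)"
      by (simp only: t_def ev_mult ev_linear mult.assoc)
    moreover have "(z - C e) * w = C c * ((x - C a) * w) + C d * ((y - C b) * w)"
      by (simp add: z_def e_def C_add C_mult algebra_simps)
    moreover have "C c * ((x - C a) * w) + C d * ((y - C b) * w) \<in> I"
      using I_add[OF I_mult[OF C_closed w(2)] I_mult[OF C_closed w(3)]] .
    ultimately show ?thesis
      using \<open>z \<in> P\<close> by (simp add: I_mult ev_closed)
  qed
  have one_root: "t * w \<in> I" if "a \<in> A" and w: "w \<in> P" "(x - C a) * w \<in> I" for a w
  proof (rule annihilator_root_cases[OF assms(2,4) \<open>t \<in> P\<close>])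
    show "w \<in> {w \<in> P. (x - C a) * w \<in> I}"
      using w by simp
    show "p * w \<in> {w \<in> P. (x - C a) * w \<in> I}"
      if "p \<in> P" "w \<in> {w \<in> P. (x - C a) * w \<in> I}" for p w
      using that I_mult[of p "(x - C a) * w"] by (simp add: P_mult mult.left_commute)
    show "ev C (\<Prod>b\<in>B. [:- b, 1:]) y * w \<in> I"
      using assms(6) w(1) by (rule I_mult_right)
  qed (use both_roots[OF \<open>a \<in> A\<close>] in auto)
  have "t * 1 \<in> I"
  proof (rule annihilator_root_cases[OF assms(1,3) \<open>t \<in> P\<close>])
    show "1 \<in> P"
      by (rule P_one)
    show "ev C (\<Prod>a\<in>A. [:- a, 1:]) x * 1 \<in> I"
      using assms(5) by simp
  qed (auto intro: P_mult one_root)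
  then show ?thesis
    by (simp add: t_def E_def z_def)
qed

end

section \<open>Base change to the algebraic closure\<close>

text \<open>
  Monomials are multisets of variables. The number \<open>n\<close> of variables is a value, so the polynomial ring
  is a subring of a type that has infinitely many variables.
\<close>

definition polys :: "nat \<Rightarrow> (nat multiset \<Rightarrow>\<^sub>0 'k::zero) set" where
  "polys n = {p. \<forall>m\<in>Poly_Mapping.keys p. set_mset m \<subseteq> {..<n}}"

abbreviation const :: "'k \<Rightarrow> nat multiset \<Rightarrow>\<^sub>0 'k::zero" where
  "const \<equiv> Poly_Mapping.single 0"

lemma polys_single: "set_mset m \<subseteq> {..<n} \<Longrightarrow> Poly_Mapping.single m c \<in> polys n"
  by (simp add: polys_def)

lemma polys_const: "const c \<in> polys n"
  by (simp add: polys_def)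

lemma polys_add: "p \<in> polys n \<Longrightarrow> q \<in> polys n \<Longrightarrow> p + q \<in> polys n"
  using Poly_Mapping.keys_add[of p q] by (auto simp: polys_def)

lemma polys_mult:
  assumes "p \<in> polys n" "q \<in> polys n"
  shows "p * q \<in> polys n"
proof -
  have "set_mset m \<subseteq> {..<n}" if m: "m \<in> Poly_Mapping.keys (p * q)" for m
  proof -
    obtain a b where "a \<in> Poly_Mapping.keys p" "b \<in> Poly_Mapping.keys q" "m = a + b"
      using Poly_Mapping.keys_mult[of p q] m by blast
    then show ?thesis
      using assms by (auto simp: polys_def)
  qed
  then show ?thesis
    by (simp add: polys_def)
qed

lemma poly_mapping_sum_singles:
  fixes p :: "'a \<Rightarrow>\<^sub>0 'b::comm_monoid_add"
  shows "p = (\<Sum>m\<in>Poly_Mapping.keys p. Poly_Mapping.single m (Poly_Mapping.lookup p m))"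
proof (rule poly_mapping_eqI)
  fix m
  have "(\<Sum>k\<in>Poly_Mapping.keys p. Poly_Mapping.lookup p k when k = m) =
      (if m \<in> Poly_Mapping.keys p then Poly_Mapping.lookup p m else 0)"
    by (simp add: when_def sum.delta)
  then show "Poly_Mapping.lookup p m =
      Poly_Mapping.lookup (\<Sum>m\<in>Poly_Mapping.keys p. Poly_Mapping.single m (Poly_Mapping.lookup p m)) m"
    by (simp add: lookup_sum lookup_single in_keys_iff)
qed

lemma polys_induct [consumes 1, case_names zero single add]:
  fixes p :: "nat multiset \<Rightarrow>\<^sub>0 'k::comm_monoid_add"
  assumes "p \<in> polys n" "Q 0"
    and single: "\<And>m c. set_mset m \<subseteq> {..<n} \<Longrightarrow> Q (Poly_Mapping.single m c)"
    and add: "\<And>p q. Q p \<Longrightarrow> Q q \<Longrightarrow> Q (p + q)"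
  shows "Q p"
proof -
  have "Q (\<Sum>m\<in>M. Poly_Mapping.single m (Poly_Mapping.lookup p m))"
    if "finite M" "M \<subseteq> Poly_Mapping.keys p" for M
    using that
  proof induction
    case (insert m M)
    then show ?case
      using assms(1) by (auto simp: polys_def intro!: add single)
  qed (simp add: assms(2))
  from this[OF _ order_refl] show ?thesis
    using poly_mapping_sum_singles[of p] by simp
qed

lemma poly_mapping_induct [case_names zero single add]:
  fixes p :: "'a \<Rightarrow>\<^sub>0 'b::comm_monoid_add"
  assumes "Q 0" and single: "\<And>m c. Q (Poly_Mapping.single m c)"
    and add: "\<And>p q. Q p \<Longrightarrow> Q q \<Longrightarrow> Q (p + q)"
  shows "Q p"
proof -
  have "Q (\<Sum>m\<in>M. Poly_Mapping.single m (Poly_Mapping.lookup p m))" if "finite M" for M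
    using that by induction (simp_all add: assms(1) single add)
  then show ?thesis
    using poly_mapping_sum_singles[of p] by (metis finite_keys)
qed

lemma lookup_map_zero:
  "f 0 = 0 \<Longrightarrow> Poly_Mapping.lookup (Poly_Mapping.map f p) m = f (Poly_Mapping.lookup p m)"
  by (simp add: Poly_Mapping.map.rep_eq when_def)

lemma map_zero: "Poly_Mapping.map f 0 = 0"
  by (simp add: map_eq_zero_iff)

lemma map_ident: "Poly_Mapping.map (\<lambda>y. y) p = p"
  by (rule poly_mapping_eqI) (simp add: lookup_map_zero)

lemma map_additive:
  assumes "\<And>x y. f (x + y) = f x + f y" "f 0 = 0"
  shows "Poly_Mapping.map f (p + q) = Poly_Mapping.map f p + Poly_Mapping.map f q"
  by (rule poly_mapping_eqI) (simp add: lookup_map_zero lookup_add assms)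

text \<open>
  Maps of coefficients that are compatible with the multiplication of coefficients are compatible
  with the multiplication of polynomials. For \<open>f = e' = g'\<close> the extension of scalars and \<open>e = g\<close> the
  identity this says that the extension of scalars is multiplicative; for \<open>e\<close> the extension of scalars
  and \<open>f = g'\<close> a \<open>K\<close>-linear functional it lets factors with coefficients in \<open>K\<close> be pulled out.
\<close>

lemma map_mult:
  fixes p :: "'m::monoid_add \<Rightarrow>\<^sub>0 'a::semiring_0" and q :: "'m \<Rightarrow>\<^sub>0 'b::semiring_0"
    and e :: "'a \<Rightarrow> 'c::semiring_0" and g :: "'b \<Rightarrow> 'c" and f :: "'c \<Rightarrow> 'd::semiring_0"
  assumes e: "\<And>x y. e (x + y) = e x + e y" "e 0 = 0"
    and g: "\<And>x y. g (x + y) = g x + g y" "g 0 = 0"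
    and f: "\<And>x y. f (x + y) = f x + f y" "f 0 = 0"
    and e': "\<And>x y. e' (x + y) = e' x + e' y" "e' 0 = 0"
    and g': "\<And>x y. g' (x + y) = g' x + g' y" "g' 0 = 0"
    and mult: "\<And>x y. f (e x * g y) = e' x * g' y"
  shows "Poly_Mapping.map f (Poly_Mapping.map e p * Poly_Mapping.map g q) =
    Poly_Mapping.map e' p * Poly_Mapping.map g' q"
proof (induction p rule: poly_mapping_induct)
  case (single m c)
  show ?case
  proof (induction q rule: poly_mapping_induct)
    case (single l d)
    then show ?case
      by (simp add: mult_single mult e g f e' g')
  qed (simp_all add: map_zero map_additive[OF g] map_additive[OF g'] map_additive[OF f] algebra_simps)
qed (simp_all add: map_zero map_additive[OF e] map_additive[OF e'] map_additive[OF f] algebra_simps)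

definition K_linear :: "('k::field alg_closure \<Rightarrow> 'k) \<Rightarrow> bool" where
  "K_linear \<phi> \<longleftrightarrow> (\<forall>x y. \<phi> (x + y) = \<phi> x + \<phi> y) \<and> (\<forall>c x. \<phi> (to_ac c * x) = c * \<phi> x)"

lemma K_linearD:
  assumes "K_linear \<phi>"
  shows "\<phi> (x + y) = \<phi> x + \<phi> y" "\<phi> (to_ac c * x) = c * \<phi> x" "\<phi> 0 = 0"
proof -
  show "\<phi> (x + y) = \<phi> x + \<phi> y" "\<phi> (to_ac c * x) = c * \<phi> x"
    using assms by (simp_all add: K_linear_def)
  have "\<phi> (to_ac 0 * 0) = 0 * \<phi> 0"
    using assms unfolding K_linear_def by blast
  then show "\<phi> 0 = 0"
    by simp
qed

text \<open>
  A nonzero vector is part of a basis, hence some linear functional takes the value \<open>1\<close> there.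
\<close>

lemma K_linear_separates:
  fixes x :: "'k::field alg_closure"
  assumes "x \<noteq> 0"
  obtains \<phi> where "K_linear \<phi>" "\<phi> x \<noteq> 0"
proof -
  interpret vector_space_pair "\<lambda>(c::'k) (x::'k alg_closure). to_ac c * x" "\<lambda>(c::'k) (x::'k). c * x"
    by unfold_locales (simp_all add: algebra_simps)
  have "vs1.independent {x}"
    using assms by (simp add: vs1.dependent_single)
  then obtain \<phi> where \<phi>: "Vector_Spaces.linear (\<lambda>(c::'k) (x::'k alg_closure). to_ac c * x) (*) \<phi>" "\<phi> x = 1"
    using linear_independent_extend[of "{x}" "\<lambda>_. 1"] by auto
  then have "K_linear \<phi>"
    by (simp add: K_linear_def Vector_Spaces.linear_iff)
  with \<phi>(2) show thesis
    using that by simp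
qed

text \<open>
  The extension of the ideal to the algebraic closure, described by functionals. A tensor
  \<open>x \<in> L \<otimes> K[x\<^sub>1, \<dots>]\<close> lies in \<open>L \<otimes> I\<close> iff every functional of \<open>L\<close> sends it into \<open>I\<close>. This form makes
  it immediate that a relation over \<open>L\<close> yields relations over \<open>K\<close>.
\<close>

definition base_change :: "nat \<Rightarrow> (nat multiset \<Rightarrow>\<^sub>0 'k::field) set \<Rightarrow> (nat multiset \<Rightarrow>\<^sub>0 'k alg_closure) set" where
  "base_change n I = {x \<in> polys n. \<forall>\<phi>. K_linear \<phi> \<longrightarrow> Poly_Mapping.map \<phi> x \<in> I}"

abbreviation extend :: "(nat multiset \<Rightarrow>\<^sub>0 'k::field) \<Rightarrow> nat multiset \<Rightarrow>\<^sub>0 'k alg_closure" where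
  "extend \<equiv> Poly_Mapping.map to_ac"

lemma map_K_linear_extend_mult:
  assumes "K_linear \<phi>"
  shows "Poly_Mapping.map \<phi> (extend p * x) = p * Poly_Mapping.map \<phi> x"
proof -
  note \<phi> = K_linearD[OF assms]
  have "Poly_Mapping.map \<phi> (extend p * Poly_Mapping.map (\<lambda>y. y) x) =
      Poly_Mapping.map (\<lambda>y. y) p * Poly_Mapping.map \<phi> x"
    by (rule map_mult) (simp_all add: \<phi>)
  then show ?thesis
    by (simp add: map_ident)
qed

lemma extend_add: "extend (p + q) = extend p + extend q"
  by (rule map_additive) simp_all

lemma extend_mult: "extend (p * q) = extend p * extend q"
proof -
  have "Poly_Mapping.map to_ac (Poly_Mapping.map (\<lambda>y. y) p * Poly_Mapping.map (\<lambda>y. y) q) =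
      Poly_Mapping.map to_ac p * Poly_Mapping.map to_ac q"
    by (rule map_mult) simp_all
  then show ?thesis
    by (simp add: map_ident)
qed

lemma extend_polys: "p \<in> polys n \<Longrightarrow> extend p \<in> polys n"
  by (auto simp: polys_def in_keys_iff lookup_map_zero)

locale poly_ideal = algebra_ideal "const :: 'k::field \<Rightarrow> _" "polys n" I for n I
begin

lemma extend_in_base_change:
  assumes "p \<in> I"
  shows "extend p \<in> base_change n I"
proof -
  have "Poly_Mapping.map \<phi> (extend p) \<in> I" if "K_linear \<phi>" for \<phi> :: "'k alg_closure \<Rightarrow> 'k"
  proof -
    have "Poly_Mapping.map \<phi> (const 1) = const (\<phi> 1)"
      by (rule map_single) (simp add: K_linearD(3)[OF that])
    then show ?thesis
      using map_K_linear_extend_mult[OF that, of p 1] I_mult_right[OF assms polys_const] by simp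
  qed
  then show ?thesis
    using assms I_subset by (auto simp: base_change_def intro!: extend_polys)
qed

text \<open>
  Closure under multiplication by a constant \<open>c\<close> holds because \<open>y \<mapsto> \<phi> (c y)\<close> is again linear.
\<close>

lemma base_change_ideal: "poly_ideal n (base_change n I)"
proof
  show "base_change n I \<subseteq> polys n"
    by (auto simp: base_change_def)
  show "0 \<in> base_change n I"
    using polys_const[of 0 n] I_zero by (simp add: base_change_def map_zero)
  show add: "x + y \<in> base_change n I" if "x \<in> base_change n I" "y \<in> base_change n I" for x y
    using that by (auto simp: base_change_def polys_add map_additive K_linearD I_add)
  show "p * x \<in> base_change n I" if "p \<in> polys n" "x \<in> base_change n I" for p x
    using that(1)
  proof (induction p rule: polys_induct)
    case zero
    then show ?case
      using polys_const[of 0 n] I_zero by (simp add: base_change_def map_zero)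
  next
    case (single m c)
    have x: "x \<in> polys n" "\<And>\<phi>. K_linear \<phi> \<Longrightarrow> Poly_Mapping.map \<phi> x \<in> I"
      using that(2) by (simp_all add: base_change_def)
    have "Poly_Mapping.map \<phi> (Poly_Mapping.single m c * x) \<in> I" if \<phi>: "K_linear \<phi>" for \<phi>
    proof -
      have "K_linear (\<lambda>y. \<phi> (c * y))"
        using \<phi> by (simp add: K_linear_def distrib_left mult.left_commute[of c "to_ac d" for d])
      then have "Poly_Mapping.single m 1 * Poly_Mapping.map (\<lambda>y. \<phi> (c * y)) x \<in> I"
        using x single by (intro I_mult polys_single)
      also have "Poly_Mapping.single m 1 * Poly_Mapping.map (\<lambda>y. \<phi> (c * y)) x =
          Poly_Mapping.map \<phi> (Poly_Mapping.single m c * x)"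
      proof (induction x rule: poly_mapping_induct)
        case (single l d)
        show ?case
          by (simp add: mult_single K_linearD(3)[OF \<phi>])
      qed (simp_all add: map_zero map_additive K_linearD[OF \<phi>] algebra_simps)
      finally show ?thesis .
    qed
    then show ?case
      using single x by (simp add: base_change_def polys_mult polys_single)
  next
    case (add p q)
    then show ?case
      by (simp add: distrib_right \<open>\<And>y x. x \<in> base_change n I \<Longrightarrow> y \<in> base_change n I \<Longrightarrow> x + y \<in> base_change n I\<close>)
  qed
qed (simp_all add: single_one single_add mult_single polys_const polys_add polys_mult)

end

context poly_ideal
begin

lemma map_K_linear_ev:
  fixes f :: "'k alg_closure poly"
  assumes "K_linear \<phi>"
  shows "Poly_Mapping.map \<phi> (ev const f (extend p)) = ev const (map_poly \<phi> f) p"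
proof -
  interpret B: poly_ideal n "base_change n I"
    by (rule base_change_ideal)
  note \<phi> = K_linearD[OF assms]
  show ?thesis
    by (induction f)
      (simp_all add: ev_0 B.ev_0 ev_pCons B.ev_pCons map_poly_pCons map_zero map_additive \<phi>
        map_K_linear_extend_mult[OF assms])
qed

lemma extend_ev:
  fixes f :: "'k poly"
  shows "extend (ev const f p) = ev const (map_poly to_ac f) (extend p)"
proof -
  interpret B: poly_ideal n "base_change n I"
    by (rule base_change_ideal)
  show ?thesis
    by (induction f)
      (simp_all add: ev_0 B.ev_0 ev_pCons B.ev_pCons map_poly_pCons map_zero extend_add extend_mult)
qed

text \<open>
  The remainder \<open>r\<close> of \<open>f\<close> modulo \<open>m\<close> still annihilates \<open>p\<close>. Applying functionals to its coefficients
  gives polynomials over \<open>K\<close> of degree less than that of \<open>m\<close> that annihilate \<open>p\<close>, so they are \<open>0\<close>; as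
  functionals separate points, \<open>r = 0\<close>.
\<close>

lemma minimal_polynomial_base_change:
  assumes m: "lead_coeff m = 1" "\<And>g. ev const g p \<in> I \<longleftrightarrow> m dvd g"
    and "p \<in> polys n" "ev const f (extend p) \<in> base_change n I"
  shows "map_poly to_ac m dvd f"
proof -
  interpret B: poly_ideal n "base_change n I"
    by (rule base_change_ideal)
  define M where "M = map_poly to_ac m"
  define r where "r = f mod M"
  have "M \<noteq> 0"
    using m(1) by (auto simp: M_def map_poly_to_ac_eq_0_iff)
  have "ev const M (extend p) \<in> base_change n I"
    using m(2)[of m] extend_in_base_change by (simp add: M_def flip: extend_ev)
  then have "ev const (f div M * M) (extend p) \<in> base_change n I"
    using assms(3) by (intro B.ev_dvd_closed[of _ M "f div M * M"] extend_polys) simp_all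
  then have "ev const f (extend p) - ev const (f div M * M) (extend p) \<in> base_change n I"
    using assms(4) by (intro B.I_diff)
  then have r_in: "ev const r (extend p) \<in> base_change n I"
    by (simp add: r_def minus_div_mult_eq_mod flip: B.ev_diff)
  have "r = 0"
  proof (rule ccontr)
    assume "r \<noteq> 0"
    then obtain \<phi> :: "'k alg_closure \<Rightarrow> 'k" where \<phi>: "K_linear \<phi>" "\<phi> (lead_coeff r) \<noteq> 0"
      using K_linear_separates[of "lead_coeff r"] by auto
    have "ev const (map_poly \<phi> r) p \<in> I"
      using r_in \<phi>(1) by (auto simp: base_change_def simp flip: map_K_linear_ev)
    then have "m dvd map_poly \<phi> r"
      by (simp add: m(2))
    moreover have "map_poly \<phi> r \<noteq> 0"
      using \<phi> K_linearD(3)[OF \<phi>(1)] by (auto simp: poly_eq_iff coeff_map_poly)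
    ultimately have "Polynomial.degree m \<le> Polynomial.degree (map_poly \<phi> r)"
      by (rule dvd_imp_degree_le)
    also have "\<dots> \<le> Polynomial.degree r"
      by (rule map_poly_degree_leq)
    also have "\<dots> < Polynomial.degree M"
      using degree_mod_less[OF \<open>M \<noteq> 0\<close>, of f] \<open>r \<noteq> 0\<close> by (simp add: r_def)
    finally show False
      by (simp add: M_def degree_map_poly_to_ac)
  qed
  then show ?thesis
    by (simp add: r_def M_def mod_eq_0_iff_dvd)
qed

text \<open>
  Here \<open>E\<close> stands for the extension of the ideal to the algebraic closure; its being radical is the
  content of quasi-perfectness. Every linear factor of \<open>m\<close> divides the product \<open>g\<close> of the distinct
  ones, so \<open>m\<close> divides a power of \<open>g\<close>, and \<open>g(p)\<close> lies in \<open>E\<close>. Minimality of \<open>m\<close> over the closure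
  then makes \<open>m\<close> divide \<open>g\<close>.
\<close>

lemma separable_minimal_polynomial:
  assumes m: "lead_coeff m = 1" "\<And>g. ev const g p \<in> I \<longleftrightarrow> m dvd g"
    and p: "p \<in> polys n"
    and E: "poly_ideal n E" "extend ` I \<subseteq> E" "E \<subseteq> base_change n I"
    and radical: "\<And>x k. x \<in> polys n \<Longrightarrow> x ^ k \<in> E \<Longrightarrow> x \<in> E"
  shows "separable_poly m"
proof -
  interpret E: poly_ideal n E
    by (rule E(1))
  have "map_poly to_ac m \<noteq> 0"
    using m(1) by (auto simp: map_poly_to_ac_eq_0_iff)
  then obtain A where A: "map_poly to_ac m = Polynomial.smult (lead_coeff (map_poly to_ac m)) (\<Prod>a\<in>#A. [:- a, 1:])"
    using alg_closed_imp_factorization by blast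
  define g where "g = (\<Prod>a\<in>set_mset A. [:- a, 1:])"
  have "(\<Prod>a\<in>#B. [:- a, 1:]) dvd g ^ size B" if "B \<subseteq># A" for B
    using that
  proof (induction B)
    case (add a B)
    then have "[:- a, 1:] dvd g"
      by (auto simp: g_def intro!: dvd_prodI dest: mset_subset_eqD)
    moreover have "B \<subseteq># A"
      using add.prems by (metis add_mset_add_single mset_subset_eq_add_left subset_mset.order_trans)
    ultimately show ?case
      using add.IH by (simp add: mult_dvd_mono del: mult_pCons_left)
  qed simp
  then have "(\<Prod>a\<in>#A. [:- a, 1:]) dvd g ^ size A"
    by simp
  then have "map_poly to_ac m dvd g ^ size A"
    using \<open>map_poly to_ac m \<noteq> 0\<close> by (subst A) (simp add: smult_dvd_iff)
  moreover have "ev const (map_poly to_ac m) (extend p) \<in> E"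
    using m(2)[of m] E(2) by (auto simp flip: extend_ev)
  ultimately have "ev const g (extend p) ^ size A \<in> E"
    unfolding E.ev_power[symmetric] using E.ev_dvd_closed[OF extend_polys[OF p]] by blast
  then have "ev const g (extend p) \<in> base_change n I"
    using radical E(3) E.ev_closed[OF extend_polys[OF p]] by blast
  then have "map_poly to_ac m dvd g"
    using minimal_polynomial_base_change[OF m p] by blast
  then show ?thesis
    unfolding g_def by (intro separable_poly_if_dvd_distinct_linear_factors[of "set_mset A"]) simp_all
qed

lemma split_base_change:
  assumes "p \<in> polys n" "separable_poly g" "ev const g p \<in> I"
  obtains A where "finite A" "ev const (\<Prod>a\<in>A. [:- a, 1:]) (extend p) \<in> base_change n I"
proof -
  interpret B: poly_ideal n "base_change n I"
    by (rule base_change_ideal)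
  obtain c A where A: "c \<noteq> 0" "finite A" "map_poly to_ac g = Polynomial.smult c (\<Prod>a\<in>A. [:- a, 1:])"
    using assms(2) by (auto simp: separable_poly_def)
  have "ev const (map_poly to_ac g) (extend p) \<in> base_change n I"
    using assms(3) extend_in_base_change by (simp flip: extend_ev)
  then have "ev const (\<Prod>a\<in>A. [:- a, 1:]) (extend p) \<in> base_change n I"
    using A(1) by (intro B.ev_dvd_closed[OF extend_polys[OF assms(1)] _ \<open>ev const (map_poly to_ac g) (extend p) \<in> _\<close>])
      (simp add: A(3) smult_dvd_iff)
  with A(2) show thesis
    by (rule that)
qed

text \<open>
  The relation \<open>f\<close> provides a minimal polynomial \<open>m\<close> of the linear combination over \<open>K\<close>. Over the
  closure \<open>m\<close> divides a product of distinct linear factors, because it is minimal there as well.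
\<close>

lemma separable_linear_combination:
  assumes p: "p \<in> polys n" "separable_poly g" "ev const g p \<in> I"
    and q: "q \<in> polys n" "separable_poly h" "ev const h q \<in> I"
    and finite: "ev const f (const c * p + const d * q) \<in> I" "f \<noteq> 0"
  obtains e where "separable_poly e" "ev const e (const c * p + const d * q) \<in> I"
proof -
  interpret B: poly_ideal n "base_change n I"
    by (rule base_change_ideal)
  obtain A where A: "finite A" "ev const (\<Prod>a\<in>A. [:- a, 1:]) (extend p) \<in> base_change n I"
    using split_base_change[OF p] .
  obtain A' where A': "finite A'" "ev const (\<Prod>a\<in>A'. [:- a, 1:]) (extend q) \<in> base_change n I"
    using split_base_change[OF q] .
  define z where "z = const c * p + const d * q"
  have z: "z \<in> polys n"
    using p q by (simp add: z_def P_add P_mult C_closed)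
  have extend_z: "extend z = const (to_ac c) * extend p + const (to_ac d) * extend q"
    by (simp add: z_def extend_add extend_mult)
  obtain m where m: "lead_coeff m = 1" "\<And>g. ev const g z \<in> I \<longleftrightarrow> m dvd g"
    using minimal_polynomial_exists[OF z] finite unfolding z_def by blast
  have "map_poly to_ac m dvd
      (\<Prod>e\<in>(\<lambda>(a, b). to_ac c * a + to_ac d * b) ` (A \<times> A'). [:- e, 1:])"
    using B.split_linear_combination[OF A(1) A'(1) extend_polys[OF p(1)] extend_polys[OF q(1)] A(2) A'(2)]
    by (intro minimal_polynomial_base_change[OF m z]) (simp add: extend_z)
  then have "separable_poly m"
    by (rule separable_poly_if_dvd_distinct_linear_factors[rotated]) (simp add: A(1) A'(1))
  then show thesis
    using that m(2)[of m] unfolding z_def by simp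
qed

end

section \<open>The polynomial ring record\<close>

abbreviation mpoly_record :: "nat \<Rightarrow> (nat multiset \<Rightarrow> 'k::field) ring" where
  "mpoly_record n \<equiv> mpoly_ring n ring_of_type_algebra"

lemma ring_of_type_algebra_simps:
  "carrier ring_of_type_algebra = UNIV"
  "x \<otimes>\<^bsub>ring_of_type_algebra\<^esub> y = x * y"
  "x \<oplus>\<^bsub>ring_of_type_algebra\<^esub> y = x + y"
  "\<one>\<^bsub>ring_of_type_algebra\<^esub> = 1"
  "\<zero>\<^bsub>ring_of_type_algebra\<^esub> = 0"
  by (simp_all add: ring_of_type_algebra_def)

lemma finsum_ring_of_type_algebra:
  fixes f :: "'b \<Rightarrow> 'k::field"
  assumes "finite A"
  shows "finsum ring_of_type_algebra f A = sum f A"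
proof -
  interpret cring "ring_of_type_algebra :: 'k ring"
    by (rule cring_from_type_algebra)
  show ?thesis
    using assms by induction (simp_all add: finsum_insert ring_of_type_algebra_simps)
qed

lemma lookup_const:
  "Poly_Mapping.lookup (const (c :: 'k::field)) = ring.indexed_const ring_of_type_algebra c"
proof -
  interpret ring "ring_of_type_algebra :: 'k ring"
    by (rule ring_from_type_algebra)
  show ?thesis
    by (auto simp: fun_eq_iff indexed_const_def lookup_single when_def ring_of_type_algebra_simps)
qed

lemma lookup_mult_var:
  fixes p :: "nat multiset \<Rightarrow>\<^sub>0 'k::field"
  shows "Poly_Mapping.lookup (p * Poly_Mapping.single {#i#} 1) m =
    (if i \<in># m then Poly_Mapping.lookup p (m - {#i#}) else 0)"
proof (induction p rule: poly_mapping_induct)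
  case (single l c)
  show ?case
    by (auto simp: mult_single lookup_single when_def)
qed (simp_all add: distrib_right lookup_add)

lemma lookup_indexed_pmult:
  fixes p :: "nat multiset \<Rightarrow>\<^sub>0 'k::field"
  shows "ring.indexed_pmult ring_of_type_algebra (Poly_Mapping.lookup p) i =
    Poly_Mapping.lookup (p * Poly_Mapping.single {#i#} 1)"
proof -
  interpret ring "ring_of_type_algebra :: 'k ring"
    by (rule ring_from_type_algebra)
  show ?thesis
    by (simp add: fun_eq_iff indexed_pmult_def ring_of_type_algebra_simps lookup_mult_var)
qed

lemma indexed_padd_lookup:
  fixes p q :: "nat multiset \<Rightarrow>\<^sub>0 'k::field"
  shows "ring.indexed_padd ring_of_type_algebra (Poly_Mapping.lookup p) (Poly_Mapping.lookup q) =
    Poly_Mapping.lookup (p + q)"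
proof -
  interpret ring "ring_of_type_algebra :: 'k ring"
    by (rule ring_from_type_algebra)
  show ?thesis
    by (simp add: fun_eq_iff indexed_padd_def ring_of_type_algebra_simps lookup_add)
qed

text \<open>
  Together with the next lemmas, this identifies the ring record with the subring \<open>polys n\<close> of the
  type of finitely supported functions.
\<close>

lemma mpoly_carrier: "carrier (mpoly_record n :: (nat multiset \<Rightarrow> 'k::field) ring) = Poly_Mapping.lookup ` polys n"
proof -
  interpret ring "ring_of_type_algebra :: 'k ring"
    by (rule ring_from_type_algebra)
  let ?S = "indexed_pset {..<n} (UNIV :: 'k set)"
  have "f \<in> Poly_Mapping.lookup ` polys n" if "f \<in> ?S" for f
    using that
  proof induction
    case (indexed_const k)
    then show ?case
      using polys_const by (metis imageI lookup_const)
  next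
    case (indexed_padd P Q)
    then show ?case
      by (auto simp: indexed_padd_lookup intro!: imageI polys_add)
  next
    case (indexed_pmult P i)
    then show ?case
      by (auto simp: lookup_indexed_pmult intro!: imageI polys_mult polys_single)
  qed
  moreover have "Poly_Mapping.lookup p \<in> ?S" if "p \<in> polys n" for p
    using that
  proof (induction p rule: polys_induct)
    case zero
    show ?case
      using indexed_pset.indexed_const[of 0 UNIV "{..<n}"] by (simp only: single_zero iso_tuple_UNIV_I flip: lookup_const)
  next
    case (single m c)
    then show ?case
    proof (induction m)
      case empty
      then show ?case
        using indexed_pset.indexed_const[of c UNIV "{..<n}"] by (simp flip: lookup_const)
    next
      case (add i m)
      have "Poly_Mapping.single (add_mset i m) c = Poly_Mapping.single m c * Poly_Mapping.single {#i#} 1"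
        by (simp add: mult_single)
      then show ?case
        using add indexed_pset.indexed_pmult[of "Poly_Mapping.lookup (Poly_Mapping.single m c)" "{..<n}" UNIV i]
        by (simp add: lookup_indexed_pmult)
    qed
  next
    case (add p q)
    then show ?case
      using indexed_pset.indexed_padd by (metis indexed_padd_lookup)
  qed
  ultimately show ?thesis
    by (auto simp: mpoly_ring_def ring_of_type_algebra_simps)
qed

lemma finite_submultisets: "finite {t. t \<subseteq># (m :: 'a multiset)}"
proof (induction m)
  case (add x m)
  have "t \<in> {t. t \<subseteq># m} \<union> add_mset x ` {t. t \<subseteq># m}" if "t \<subseteq># add_mset x m" for t
  proof (cases "x \<in># t")
    case True
    then obtain t' where "t = add_mset x t'"
      by (metis mset_add)
    then show ?thesis
      using that by simp
  next
    case False
    then show ?thesis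
      using that by (simp add: subset_mset.le_iff_sup)
  qed
  then have "{t. t \<subseteq># add_mset x m} \<subseteq> {t. t \<subseteq># m} \<union> add_mset x ` {t. t \<subseteq># m}"
    by blast
  then show ?case
    by (rule finite_subset) (simp add: add.IH)
qed simp

lemma sum_submultisets_lookup_mult:
  fixes p q :: "'a multiset \<Rightarrow>\<^sub>0 'k::comm_semiring_1"
  shows "(\<Sum>t\<in>{t. t \<subseteq># m}. Poly_Mapping.lookup p t * Poly_Mapping.lookup q (m - t)) =
    Poly_Mapping.lookup (p * q) m"
proof (induction p rule: poly_mapping_induct)
  case (single l c)
  show ?case
  proof (induction q rule: poly_mapping_induct)
    case (single k d)
    have "(\<Sum>t\<in>{t. t \<subseteq># m}. (c when l = t) * (d when k = m - t)) =
        (\<Sum>t\<in>{t. t \<subseteq># m}. if t = l then c * (d when k = m - l) else 0)"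
      by (rule sum.cong) (auto simp: when_def)
    also have "\<dots> = (if l \<subseteq># m then c * (d when k = m - l) else 0)"
      by (simp add: finite_submultisets)
    also have "\<dots> = (c * d when l + k = m)"
      by (auto simp: when_def) (metis mset_subset_eq_add_left)
    finally show ?case
      by (simp add: mult_single lookup_single)
  qed (simp_all add: lookup_add distrib_left sum.distrib)
qed (simp_all add: lookup_add distrib_right sum.distrib)

lemma mpoly_mult:
  fixes p q :: "nat multiset \<Rightarrow>\<^sub>0 'k::field"
  shows "Poly_Mapping.lookup p \<otimes>\<^bsub>mpoly_record n\<^esub> Poly_Mapping.lookup q = Poly_Mapping.lookup (p * q)"
  by (simp add: fun_eq_iff mpoly_ring_def finsum_ring_of_type_algebra finite_submultisets
      ring_of_type_algebra_simps sum_submultisets_lookup_mult)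

lemma mpoly_add:
  "Poly_Mapping.lookup p \<oplus>\<^bsub>mpoly_record n\<^esub> Poly_Mapping.lookup q = Poly_Mapping.lookup (p + q)"
  by (simp add: mpoly_ring_def indexed_padd_lookup)

lemma mpoly_one: "\<one>\<^bsub>mpoly_record n\<^esub> = Poly_Mapping.lookup 1"
  by (simp add: mpoly_ring_def ring_of_type_algebra_simps flip: lookup_const)

lemma mpoly_zero: "\<zero>\<^bsub>mpoly_record n\<^esub> = Poly_Mapping.lookup 0"
  by (simp add: mpoly_ring_def ring_of_type_algebra_simps flip: lookup_const)

lemmas mpoly_simps = mpoly_carrier mpoly_mult mpoly_add mpoly_one mpoly_zero

lemma polys_0: "0 \<in> polys n" and polys_1: "1 \<in> polys n"
  by (simp_all add: polys_def)

lemma polys_uminus: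
  fixes p :: "nat multiset \<Rightarrow>\<^sub>0 'k::ring_1"
  shows "p \<in> polys n \<Longrightarrow> - p \<in> polys n"
  by (auto simp: polys_def in_keys_iff)

lemma cring_mpoly: "cring (mpoly_record n :: (nat multiset \<Rightarrow> 'k::field) ring)"
proof (rule cringI)
  show "abelian_group (mpoly_record n :: (nat multiset \<Rightarrow> 'k) ring)"
  proof (rule abelian_groupI)
    show "\<exists>y\<in>carrier (mpoly_record n). y \<oplus>\<^bsub>mpoly_record n\<^esub> x = \<zero>\<^bsub>mpoly_record n\<^esub>"
      if x: "x \<in> carrier (mpoly_record n)" for x :: "nat multiset \<Rightarrow> 'k"
    proof -
      obtain p where p: "p \<in> polys n" "x = Poly_Mapping.lookup p"
        using x by (auto simp: mpoly_carrier)
      have "Poly_Mapping.lookup (- p) \<oplus>\<^bsub>mpoly_record n\<^esub> x = \<zero>\<^bsub>mpoly_record n\<^esub>"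
        by (simp add: p(2) mpoly_simps)
      moreover have "Poly_Mapping.lookup (- p) \<in> carrier (mpoly_record n)"
        using polys_uminus[OF p(1)] by (simp add: mpoly_carrier)
      ultimately show ?thesis
        by blast
    qed
  qed (auto simp: mpoly_simps polys_0 ac_simps intro!: imageI polys_add)
  show "comm_monoid (mpoly_record n :: (nat multiset \<Rightarrow> 'k) ring)"
    by (rule comm_monoidI) (auto simp: mpoly_simps polys_1 ac_simps intro!: imageI polys_mult)
qed (auto simp: mpoly_simps distrib_right)

lemma mpoly_pow:
  fixes p :: "nat multiset \<Rightarrow>\<^sub>0 'k::field"
  shows "Poly_Mapping.lookup p [^]\<^bsub>mpoly_record n\<^esub> (k::nat) = Poly_Mapping.lookup (p ^ k)"
  by (induction k) (simp_all add: nat_pow_def mpoly_one mpoly_mult mult.commute)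

lemma poly_ideal_if_ideal:
  fixes I :: "(nat multiset \<Rightarrow> 'k::field) set"
  assumes "ideal I (mpoly_record n)"
  shows "poly_ideal n {p. Poly_Mapping.lookup p \<in> I}"
    and "I = Poly_Mapping.lookup ` {p. Poly_Mapping.lookup p \<in> I}"
proof -
  interpret ideal I "mpoly_record n"
    by (rule assms)
  have "I \<subseteq> Poly_Mapping.lookup ` polys n"
    using a_subset by (simp add: mpoly_carrier)
  then show "I = Poly_Mapping.lookup ` {p. Poly_Mapping.lookup p \<in> I}"
    by blast
  show "poly_ideal n {p. Poly_Mapping.lookup p \<in> I}"
  proof
    show "{p. Poly_Mapping.lookup p \<in> I} \<subseteq> polys n"
      using a_subset by (auto simp: mpoly_carrier lookup_inject)
    show "0 \<in> {p. Poly_Mapping.lookup p \<in> I}"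
      using additive_subgroup.zero_closed[OF is_additive_subgroup] by (simp add: mpoly_zero)
    show "x + y \<in> {p. Poly_Mapping.lookup p \<in> I}"
      if "x \<in> {p. Poly_Mapping.lookup p \<in> I}" "y \<in> {p. Poly_Mapping.lookup p \<in> I}" for x y
      using additive_subgroup.a_closed[OF is_additive_subgroup, of "Poly_Mapping.lookup x" "Poly_Mapping.lookup y"] that
      by (simp add: mpoly_add)
    show "p * x \<in> {p. Poly_Mapping.lookup p \<in> I}"
      if "p \<in> polys n" "x \<in> {p. Poly_Mapping.lookup p \<in> I}" for p x
      using I_l_closed[of "Poly_Mapping.lookup x" "Poly_Mapping.lookup p"] that
      by (simp add: mpoly_carrier mpoly_mult)
  qed (simp_all add: single_one single_add mult_single polys_const polys_add polys_mult)
qed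

lemma ideal_if_poly_ideal:
  fixes I :: "(nat multiset \<Rightarrow>\<^sub>0 'k::field) set"
  assumes "poly_ideal n I"
  shows "ideal (Poly_Mapping.lookup ` I) (mpoly_record n)"
proof -
  interpret I: poly_ideal n I
    by (rule assms)
  interpret R: cring "mpoly_record n :: (nat multiset \<Rightarrow> 'k) ring"
    by (rule cring_mpoly)
  show ?thesis
  proof (rule idealI)
    show "subgroup (Poly_Mapping.lookup ` I) (add_monoid (mpoly_record n))"
    proof (rule R.add.subgroupI)
      show "Poly_Mapping.lookup ` I \<subseteq> carrier (mpoly_record n)"
        using I.I_subset by (auto simp: mpoly_carrier)
      show "Poly_Mapping.lookup ` I \<noteq> {}"
        using I.I_zero by blast
      show "\<ominus>\<^bsub>mpoly_record n\<^esub> x \<in> Poly_Mapping.lookup ` I" if x: "x \<in> Poly_Mapping.lookup ` I" for x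
      proof -
        obtain p where p: "p \<in> I" "x = Poly_Mapping.lookup p"
          using x by blast
        have "\<ominus>\<^bsub>mpoly_record n\<^esub> x = Poly_Mapping.lookup (- p)"
          using p I.I_subset polys_uminus
          by (intro R.minus_equality) (auto simp: mpoly_simps)
        then show ?thesis
          using I.I_uminus[OF p(1)] by blast
      qed
    qed (auto simp: mpoly_add intro!: imageI I.I_add)
  qed (auto simp: mpoly_carrier mpoly_mult R.ring_axioms I.I_mult I.I_mult_right intro!: imageI)
qed

lemma to_ac_ring_hom: "to_ac \<in> ring_hom ring_of_type_algebra ring_of_type_algebra"
  by (rule ring_hom_memI) (simp_all add: ring_of_type_algebra_simps)

lemma lookup_extend: "Poly_Mapping.lookup (extend p) = to_ac \<circ> Poly_Mapping.lookup p"
  by (simp add: fun_eq_iff lookup_map_zero)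

text \<open>
  Separability is applied to the algebraic closure as extension field. The ideal \<open>E\<close> generated by
  the extension of \<open>J\<close> is contained in \<open>base_change n J\<close>, since the latter is an ideal that contains
  the generators.
\<close>

lemma quasi_perfect_field_radical_over_closure:
  fixes I :: "(nat multiset \<Rightarrow> 'k::field) set"
  assumes "ideal I (mpoly_record n)"
    and "quasi_perfect_field TYPE('k alg_closure) n ring_of_type_algebra I ring_of_type_algebra id"
  defines "J \<equiv> {p \<in> polys n. \<exists>k. Poly_Mapping.lookup (p ^ k) \<in> I}"
  obtains E where "poly_ideal n J" "poly_ideal n E" "extend ` J \<subseteq> E" "E \<subseteq> base_change n J"
    "\<And>x k. x \<in> polys n \<Longrightarrow> x ^ k \<in> E \<Longrightarrow> x \<in> E"
proof -
  interpret R: cring "mpoly_record n :: (nat multiset \<Rightarrow> 'k) ring"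
    by (rule cring_mpoly)
  interpret S: cring "mpoly_record n :: (nat multiset \<Rightarrow> 'k alg_closure) ring"
    by (rule cring_mpoly)
  define J0 where "J0 = radical (mpoly_record n) (extend_ideal n ring_of_type_algebra id I)"
  have "I \<subseteq> carrier (mpoly_record n)"
    using ideal.Icarr[OF assms(1)] by blast
  then have "Idl\<^bsub>mpoly_record n\<^esub> I = I"
    by (intro equalityI R.genideal_minimal[OF assms(1) order_refl] R.genideal_self)
  then have "extend_ideal n ring_of_type_algebra id I = I"
    by (simp add: extend_ideal_def)
  then have J0: "J0 = radical (mpoly_record n) I"
    by (simp add: J0_def)
  have "{p. Poly_Mapping.lookup p \<in> J0} = J"
    by (auto simp: J0 J_def radical_def mpoly_carrier mpoly_pow lookup_inject)
  have separable: "separable_ideal TYPE('k alg_closure) n ring_of_type_algebra J0"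
    using assms(2) by (simp add: quasi_perfect_field_def J0_def)
  then have "ideal J0 (mpoly_record n)"
    by (simp add: separable_ideal_def radical_ideal_def)
  note J = poly_ideal_if_ideal[OF this, unfolded \<open>{p. Poly_Mapping.lookup p \<in> J0} = J\<close>]
  interpret J: poly_ideal n J
    by (rule J(1))
  define E0 where "E0 = extend_ideal n (ring_of_type_algebra :: 'k alg_closure ring) to_ac J0"
  have "extension_field (ring_of_type_algebra :: 'k ring) (ring_of_type_algebra :: 'k alg_closure ring) to_ac"
    unfolding extension_field_def by (intro conjI field_from_type_algebra to_ac_ring_hom)
  then have E0: "radical_ideal (mpoly_record n) E0"
    using separable unfolding separable_ideal_def E0_def by (elim conjE allE impE)
  then have "ideal E0 (mpoly_record n)"
    by (simp add: radical_ideal_def)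
  note E = poly_ideal_if_ideal[OF this]
  define E where "E = {p. Poly_Mapping.lookup p \<in> E0}"
  have image: "(\<lambda>f. to_ac \<circ> f) ` J0 = Poly_Mapping.lookup ` extend ` J"
    by (simp add: J(2) image_image lookup_extend)
  have E0_def': "E0 = Idl\<^bsub>mpoly_record n\<^esub> (Poly_Mapping.lookup ` extend ` J)"
    by (simp only: E0_def extend_ideal_def image)
  have "extend ` J \<subseteq> polys n"
    using J.I_subset extend_polys by blast
  then have "Poly_Mapping.lookup ` extend ` J \<subseteq> E0"
    unfolding E0_def' by (intro S.genideal_self) (auto simp: mpoly_carrier)
  then have "extend ` J \<subseteq> E"
    by (auto simp: E_def)
  have "E0 \<subseteq> Poly_Mapping.lookup ` base_change n J"
    unfolding E0_def' using J.extend_in_base_change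
    by (intro S.genideal_minimal ideal_if_poly_ideal J.base_change_ideal) blast
  then have "E \<subseteq> base_change n J"
    by (auto simp: E_def lookup_inject)
  have "x \<in> E" if "x \<in> polys n" "x ^ k \<in> E" for x k
  proof -
    have "Poly_Mapping.lookup x \<in> radical (mpoly_record n) E0"
      using that by (auto simp: radical_def mpoly_carrier mpoly_pow E_def)
    then show ?thesis
      using E0 by (simp add: radical_ideal_def E_def)
  qed
  then show thesis
    by (rule that[OF J(1) E(1)[folded E_def] \<open>extend ` J \<subseteq> E\<close> \<open>E \<subseteq> base_change n J\<close>])
qed

section \<open>Residue classes\<close>

lemma monic_dvd_antisym:
  fixes f g :: "'k::field poly"
  assumes "lead_coeff f = 1" "lead_coeff g = 1" "f dvd g" "g dvd f"
  shows "f = g"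
proof -
  obtain h where h: "g = f * h"
    using assms(3) ..
  have nonzero: "f \<noteq> 0" "h \<noteq> 0"
    using assms(1,2) h by auto
  have "Polynomial.degree g \<le> Polynomial.degree f"
    using assms(4) nonzero(1) by (rule dvd_imp_degree_le)
  then have "Polynomial.degree h = 0"
    using nonzero by (simp add: h degree_mult_eq)
  moreover have "lead_coeff h = 1"
    using assms(1,2) by (simp add: h lead_coeff_mult)
  ultimately have "h = 1"
    by (auto elim!: degree_eq_zeroE simp: one_pCons)
  then show ?thesis
    by (simp add: h)
qed

text \<open>
  Krull's theorem: Zorn's lemma applied to the proper ideals that contain \<open>a\<close>.
\<close>

lemma (in cring) nonunit_in_maximalideal:
  assumes "a \<in> carrier R" "a \<notin> Units R"
  obtains N where "maximalideal N R" "a \<in> N"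
proof -
  define \<A> where "\<A> = {J. ideal J R \<and> a \<in> J \<and> \<one> \<notin> J}"
  have "\<one> \<notin> PIdl a"
  proof
    assume "\<one> \<in> PIdl a"
    then obtain x where "x \<in> carrier R" "\<one> = x \<otimes> a"
      by (auto simp: cgenideal_def)
    then show False
      using assms m_comm[of x a] by (auto simp: Units_def)
  qed
  then have "PIdl a \<in> \<A>"
    using assms(1) by (simp add: \<A>_def cgenideal_ideal cgenideal_self)
  moreover have "\<Union>\<C> \<in> \<A>" if "\<C> \<noteq> {}" "subset.chain \<A> \<C>" for \<C>
  proof -
    have "subset.chain {J. ideal J R} \<C>"
      using that(2) by (auto simp: subset.chain_def \<A>_def)
    then have "ideal (\<Union>\<C>) R"
      using chain_Union_is_ideal[of \<C>] that(1) by simp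
    then show ?thesis
      using that by (auto simp: subset.chain_def \<A>_def)
  qed
  ultimately obtain N where N: "N \<in> \<A>" "\<And>J. J \<in> \<A> \<Longrightarrow> N \<subseteq> J \<Longrightarrow> J = N"
    using subset_Zorn_nonempty[of \<A>] by blast
  have "maximalideal N R"
  proof (rule maximalidealI)
    show "ideal N R" "carrier R \<noteq> N"
      using N(1) by (auto simp: \<A>_def)
    show "J = N \<or> J = carrier R" if "ideal J R" "N \<subseteq> J" for J
      using that N ideal.one_imp_carrier[of J R] by (auto simp: \<A>_def)
  qed
  then show thesis
    using that N(1) by (simp add: \<A>_def)
qed

lemma (in primeideal) pow_mem_imp_mem:
  assumes "x \<in> carrier R" "x [^] (k::nat) \<in> I"
  shows "x \<in> I"
  using assms(2)
proof (induction k)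
  case 0
  then show ?case
    using one_imp_carrier assms(1) by simp
next
  case (Suc k)
  then show ?case
    using I_prime[of "x [^] k" x] assms(1) by auto
qed

locale affine_quotient =
  fixes n :: nat and I0 :: "(nat multiset \<Rightarrow> 'k::field) set"
  assumes I0: "ideal I0 (mpoly_record n)"
begin

abbreviation R where "R \<equiv> affine_algebra n ring_of_type_algebra I0"

definition I where "I = {p. Poly_Mapping.lookup p \<in> I0}"

definition cls where "cls p = I0 +>\<^bsub>mpoly_record n\<^esub> Poly_Mapping.lookup p"

sublocale poly_ideal n I
  unfolding I_def by (rule poly_ideal_if_ideal(1)[OF I0])

sublocale M: cring "mpoly_record n :: (nat multiset \<Rightarrow> 'k) ring"
  by (rule cring_mpoly)

sublocale I0: ideal I0 "mpoly_record n"
  by (rule I0)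

sublocale R: cring R
  unfolding affine_algebra_def by (rule I0.quotient_is_cring[OF cring_mpoly])

lemma scalar_eq_cls: "scalar n ring_of_type_algebra I0 c = cls (const c)"
  by (simp add: scalar_def cls_def lookup_const)

lemma cls_hom: "(+>\<^bsub>mpoly_record n\<^esub>) I0 \<in> ring_hom (mpoly_record n) R"
  unfolding affine_algebra_def by (rule I0.rcos_ring_hom)

lemma carrier_R: "carrier R = cls ` polys n"
  by (auto simp: affine_algebra_def FactRing_def A_RCOSETS_def' mpoly_carrier cls_def)

lemma cls_closed: "p \<in> polys n \<Longrightarrow> cls p \<in> carrier R"
  by (simp add: carrier_R)

lemma cls_add: "p \<in> polys n \<Longrightarrow> q \<in> polys n \<Longrightarrow> cls p \<oplus>\<^bsub>R\<^esub> cls q = cls (p + q)"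
  using ring_hom_add[OF cls_hom, of "Poly_Mapping.lookup p" "Poly_Mapping.lookup q"]
  by (simp add: cls_def mpoly_carrier mpoly_add)

lemma cls_mult: "p \<in> polys n \<Longrightarrow> q \<in> polys n \<Longrightarrow> cls p \<otimes>\<^bsub>R\<^esub> cls q = cls (p * q)"
  using ring_hom_mult[OF cls_hom, of "Poly_Mapping.lookup p" "Poly_Mapping.lookup q"]
  by (simp add: cls_def mpoly_carrier mpoly_mult)

lemma cls_one: "\<one>\<^bsub>R\<^esub> = cls 1"
  using ring_hom_one[OF cls_hom] by (simp add: cls_def mpoly_one)

lemma cls_zero: "\<zero>\<^bsub>R\<^esub> = cls 0"
  using ring_hom_zero[OF cls_hom M.ring_axioms R.ring_axioms] by (simp add: cls_def mpoly_zero)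

lemma cls_pow: "p \<in> polys n \<Longrightarrow> cls p [^]\<^bsub>R\<^esub> (k::nat) = cls (p ^ k)"
  by (induction k) (simp_all add: cls_one cls_mult P_power mult.commute)

lemma cls_eq_0_iff:
  assumes "p \<in> polys n"
  shows "cls p = \<zero>\<^bsub>R\<^esub> \<longleftrightarrow> p \<in> I"
proof -
  have "\<zero>\<^bsub>R\<^esub> = I0"
    by (simp add: affine_algebra_def FactRing_def)
  then show ?thesis
    using assms I0.a_rcos_const I0.a_rcos_self[of "Poly_Mapping.lookup p"]
    by (auto simp: I_def cls_def mpoly_carrier)
qed

lemma cls_uminus: "p \<in> polys n \<Longrightarrow> \<ominus>\<^bsub>R\<^esub> cls p = cls (- p)"
  by (rule R.minus_equality) (simp_all add: cls_add cls_zero cls_closed P_uminus)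

lemma cls_eq_iff:
  assumes "p \<in> polys n" "q \<in> polys n"
  shows "cls p = cls q \<longleftrightarrow> p - q \<in> I"
proof -
  have "cls p = cls q \<longleftrightarrow> cls p \<ominus>\<^bsub>R\<^esub> cls q = \<zero>\<^bsub>R\<^esub>"
    using assms by (simp add: cls_closed R.r_right_minus_eq)
  also have "cls p \<ominus>\<^bsub>R\<^esub> cls q = cls (p - q)"
    using assms by (simp add: a_minus_def cls_uminus cls_add P_uminus)
  finally show ?thesis
    using assms by (simp add: cls_eq_0_iff P_diff)
qed

lemma cls_sum:
  assumes "finite A" "\<And>a. a \<in> A \<Longrightarrow> f a \<in> polys n"
  shows "finsum R (\<lambda>a. cls (f a)) A = cls (sum f A) \<and> sum f A \<in> polys n"
  using assms
proof induction
  case empty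
  then show ?case
    by (simp add: cls_zero P_zero)
next
  case (insert a A)
  then show ?case
    by (subst R.finsum_insert) (auto simp: cls_add cls_closed P_add)
qed

lemma eval_at_cls:
  assumes p: "p \<in> polys n"
  shows "eval_at n I0 (cls p) f = cls (ev const f p)"
proof -
  have "const c \<noteq> 0" if "c \<noteq> 0" for c :: 'k
    using that by (metis lookup_single_eq lookup_zero)
  then have "Polynomial.degree (map_poly (const :: 'k \<Rightarrow> _) f) = Polynomial.degree f" for f :: "'k poly"
    by (cases "f = 0") (auto intro: map_poly_degree_eq)
  then have ev: "ev const f p = (\<Sum>i\<le>Polynomial.degree f. const (Polynomial.coeff f i) * p ^ i)"
    by (simp add: ev_def poly_altdef coeff_map_poly)
  have "eval_at n I0 (cls p) f =
      finsum R (\<lambda>i. cls (const (Polynomial.coeff f i)) \<otimes>\<^bsub>R\<^esub> cls p [^]\<^bsub>R\<^esub> i) {..Polynomial.degree f}"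
    by (simp add: eval_at_def Let_def scalar_eq_cls)
  also have "\<dots> = finsum R (\<lambda>i. cls (const (Polynomial.coeff f i) * p ^ i)) {..Polynomial.degree f}"
    using p by (simp add: cls_pow cls_mult C_closed P_power)
  also have "\<dots> = cls (ev const f p)"
    unfolding ev using p by (intro conjunct1[OF cls_sum]) (simp_all add: C_closed P_power P_mult)
  finally show ?thesis .
qed

lemma min_poly_cls:
  assumes "p \<in> polys n" "lead_coeff m = 1" "\<And>g. ev const g p \<in> I \<longleftrightarrow> m dvd g"
  shows "min_poly n I0 (cls p) = m"
  unfolding min_poly_def
proof (rule the_equality)
  have eval: "eval_at n I0 (cls p) g = \<zero>\<^bsub>R\<^esub> \<longleftrightarrow> m dvd g" for g
    using assms by (simp add: eval_at_cls cls_eq_0_iff ev_closed)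
  then show "lead_coeff m = 1 \<and> (\<forall>g. eval_at n I0 (cls p) g = \<zero>\<^bsub>R\<^esub> \<longleftrightarrow> m dvd g)"
    using assms(2) by blast
  show "f = m" if "lead_coeff f = 1 \<and> (\<forall>g. eval_at n I0 (cls p) g = \<zero>\<^bsub>R\<^esub> \<longleftrightarrow> f dvd g)" for f
    using that assms(2) eval by (intro monic_dvd_antisym) auto
qed

lemma separable_elements_eq:
  assumes finite: "\<And>p. p \<in> polys n \<Longrightarrow> \<exists>f. f \<noteq> 0 \<and> ev const f p \<in> I"
  shows "separable_elements n I0 =
    cls ` {p \<in> polys n. \<exists>g. separable_poly g \<and> ev const g p \<in> I}"
proof -
  have "separable_poly (min_poly n I0 (cls p)) \<longleftrightarrow> (\<exists>g. separable_poly g \<and> ev const g p \<in> I)"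
    if p: "p \<in> polys n" for p
  proof -
    obtain m where m: "lead_coeff m = 1" "\<And>g. ev const g p \<in> I \<longleftrightarrow> m dvd g"
      using minimal_polynomial_exists[OF p] finite[OF p] by metis
    then show ?thesis
      using min_poly_cls[OF p m] separable_poly_divisor by auto
  qed
  then show ?thesis
    by (auto simp: separable_elements_def carrier_R)
qed

text \<open>
  If \<open>x\<close> lies in all maximal ideals and is annihilated by \<open>z ^ k w(z)\<close> with \<open>w(0) \<noteq> 0\<close>, then \<open>w(x)\<close> is
  congruent to the nonzero constant \<open>w(0)\<close> modulo every maximal ideal. So \<open>w(x)\<close> is a unit and
  \<open>x ^ k = 0\<close>.
\<close>

lemma zero_radical_eq:
  assumes finite: "\<And>p. p \<in> polys n \<Longrightarrow> \<exists>f. f \<noteq> 0 \<and> ev const f p \<in> I"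
  shows "zero_radical R = cls ` {p \<in> polys n. \<exists>k. p ^ k \<in> I}"
proof -
  have "\<exists>k. p ^ k \<in> I" if p: "p \<in> polys n" and max: "\<And>N. maximalideal N R \<Longrightarrow> cls p \<in> N" for p
  proof -
    obtain f where f: "f \<noteq> 0" "ev const f p \<in> I"
      using finite[OF p] by blast
    define k where "k = order 0 f"
    obtain w where w: "f = [:- 0, 1:] ^ k * w" "\<not> [:- 0, 1:] dvd w"
      using order_decomp[OF f(1), of 0] unfolding k_def by blast
    obtain c h where h: "w = pCons c h"
      by (rule pCons_cases)
    have "c \<noteq> 0"
      using w(2) poly_eq_0_iff_dvd[of w 0] by (simp add: h)
    have ev_w: "ev const w p = const c + p * ev const h p"
      by (simp add: h ev_pCons)
    have "cls (ev const w p) \<in> Units R"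
    proof (rule ccontr)
      assume "cls (ev const w p) \<notin> Units R"
      then obtain N where N: "maximalideal N R" "cls (ev const w p) \<in> N"
        using R.nonunit_in_maximalideal cls_closed[OF ev_closed[OF p]] by blast
      interpret N: maximalideal N R
        by (rule N(1))
      have "cls p \<otimes>\<^bsub>R\<^esub> cls (ev const (- h) p) \<in> N"
        using max[OF N(1)] p by (simp add: N.I_r_closed cls_closed ev_closed)
      then have "cls (ev const w p) \<oplus>\<^bsub>R\<^esub> cls p \<otimes>\<^bsub>R\<^esub> cls (ev const (- h) p) \<in> N"
        using N(2) by (intro N.a_closed)
      then have "cls (const (inverse c)) \<otimes>\<^bsub>R\<^esub>
          (cls (ev const w p) \<oplus>\<^bsub>R\<^esub> cls p \<otimes>\<^bsub>R\<^esub> cls (ev const (- h) p)) \<in> N"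
        by (intro N.I_l_closed cls_closed C_closed)
      also have "cls (const (inverse c)) \<otimes>\<^bsub>R\<^esub>
          (cls (ev const w p) \<oplus>\<^bsub>R\<^esub> cls p \<otimes>\<^bsub>R\<^esub> cls (ev const (- h) p)) =
          cls (const (inverse c) * (ev const w p + p * ev const (- h) p))"
        using p by (simp add: cls_mult cls_add ev_closed P_mult P_add C_closed)
      also have "const (inverse c) * (ev const w p + p * ev const (- h) p) = 1"
      proof -
        have "ev const (- h) p = - ev const h p"
          using ev_diff[of 0 h p] by (simp add: ev_0)
        then show ?thesis
          using \<open>c \<noteq> 0\<close> by (simp add: ev_w mult_single)
      qed
      finally have "\<one>\<^bsub>R\<^esub> \<in> N"
        by (simp add: cls_one)
      then show False
        using N.one_imp_carrier N.I_notcarr by blast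
    qed
    then obtain v where v: "v \<in> carrier R" "v \<otimes>\<^bsub>R\<^esub> cls (ev const w p) = \<one>\<^bsub>R\<^esub>"
      by (auto simp: Units_def)
    have "cls (p ^ k) \<otimes>\<^bsub>R\<^esub> cls (ev const w p) = \<zero>\<^bsub>R\<^esub>"
      using f(2) p by (simp add: w(1) ev_mult ev_power ev_pCons ev_0 C_0 C_1 cls_mult cls_eq_0_iff P_power P_mult ev_closed)
    then have "v \<otimes>\<^bsub>R\<^esub> (cls (p ^ k) \<otimes>\<^bsub>R\<^esub> cls (ev const w p)) = \<zero>\<^bsub>R\<^esub>"
      using v(1) by simp
    moreover have "v \<otimes>\<^bsub>R\<^esub> (cls (p ^ k) \<otimes>\<^bsub>R\<^esub> cls (ev const w p)) =
        cls (p ^ k) \<otimes>\<^bsub>R\<^esub> (v \<otimes>\<^bsub>R\<^esub> cls (ev const w p))"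
      using v(1) p by (intro R.m_lcomm) (simp_all add: cls_closed P_power ev_closed)
    ultimately have "cls (p ^ k) = \<zero>\<^bsub>R\<^esub>"
      using p v(2) by (simp add: cls_closed P_power)
    then show ?thesis
      using p by (auto simp: cls_eq_0_iff P_power)
  qed
  moreover have "cls p \<in> N" if p: "p \<in> polys n" "p ^ k \<in> I" and N: "maximalideal N R" for p k N
  proof -
    interpret N: primeideal N R
      by (rule R.maximalideal_prime[OF N])
    have "cls p [^]\<^bsub>R\<^esub> k = \<zero>\<^bsub>R\<^esub>"
      using p by (simp add: cls_pow cls_eq_0_iff P_power)
    then show ?thesis
      using N.pow_mem_imp_mem[of "cls p" k] p(1) by (simp add: cls_closed)
  qed
  ultimately show ?thesis
    by (auto simp: zero_radical_def carrier_R)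
qed

lemma combine_powers:
  assumes "p \<in> polys n"
  shows "R.combine (map (\<lambda>c. cls (const c)) cs) (map (\<lambda>i. cls (p ^ i)) [j..<j + length cs]) =
    cls (p ^ j * ev const (Poly cs) p)"
proof (induction cs arbitrary: j)
  case Nil
  then show ?case
    by (simp add: ev_0 cls_zero)
next
  case (Cons c cs)
  have "[j..<j + length (c # cs)] = j # [Suc j..<Suc j + length cs]"
    by (simp add: upt_rec)
  then show ?case
    using Cons[of "Suc j"] assms
    by (simp add: cls_mult cls_add ev_pCons C_closed P_power P_mult P_add ev_closed algebra_simps del: upt_Suc)
qed

text \<open>
  The powers of an element of a finite-dimensional algebra are linearly dependent. The zero ring has
  to be treated separately, because the image of \<open>K\<close> in it is not a field.
\<close>

lemma zero_dimensional_algebraic: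
  assumes "zero_dimensional n ring_of_type_algebra I0" and p: "p \<in> polys n"
  shows "\<exists>f. f \<noteq> 0 \<and> ev const f p \<in> I"
proof (cases "1 \<in> I")
  case True
  then show ?thesis
    by (intro exI[of _ 1]) (simp add: ev_1)
next
  case False
  let ?K = "scalar n ring_of_type_algebra I0 ` carrier (ring_of_type_algebra :: 'k ring)"
  interpret K: field "ring_of_type_algebra :: 'k ring"
    by (rule field_from_type_algebra)
  have "scalar n ring_of_type_algebra I0 \<in> ring_hom ring_of_type_algebra R"
    by (rule ring_hom_memI)
      (simp_all add: scalar_eq_cls ring_of_type_algebra_simps cls_mult cls_add cls_one cls_closed
        C_closed C_mult C_add)
  then interpret h: ring_hom_ring ring_of_type_algebra R "scalar n ring_of_type_algebra I0"
    by (intro ring_hom_ringI2 K.ring_axioms R.ring_axioms)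
  have "\<one>\<^bsub>R\<^esub> \<noteq> \<zero>\<^bsub>R\<^esub>"
    using False cls_eq_0_iff[OF P_one] by (simp add: cls_one)
  then have K: "subfield ?K R"
    by (intro h.img_is_subfield(2) K.carrier_is_subfield)
  obtain d where d: "R.dimension d ?K (carrier R)"
    using assms(1) by (auto simp: zero_dimensional_def R.finite_dimension_def)
  define Us where "Us = map (\<lambda>i. cls (p ^ i)) [0..<Suc d]"
  have Us: "set Us \<subseteq> carrier R"
    using p by (auto simp: Us_def intro!: cls_closed P_power)
  have "\<not> R.independent ?K Us"
    using R.independent_length_le_dimension[OF K d _ Us] by (auto simp: Us_def)
  then obtain Ks where Ks: "length Ks = length Us" "R.combine Ks Us = \<zero>\<^bsub>R\<^esub>"
      "set Ks \<subseteq> ?K" "set Ks \<noteq> {\<zero>\<^bsub>R\<^esub>}"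
    using R.dependent_imp_non_trivial_combine[OF K Us] by blast
  have "\<forall>k\<in>set Ks. \<exists>c. k = cls (const c)"
    using Ks(3) by (auto simp: scalar_eq_cls)
  then obtain c where c: "\<And>k. k \<in> set Ks \<Longrightarrow> k = cls (const (c k))"
    by metis
  define cs where "cs = map c Ks"
  have "map (\<lambda>k. cls (const (c k))) Ks = Ks"
    by (rule map_idI) (rule c[symmetric])
  then have Ks_eq: "Ks = map (\<lambda>c. cls (const c)) cs"
    by (simp add: cs_def comp_def)
  have len: "length cs = Suc d"
    using Ks(1) by (simp add: cs_def Us_def)
  have "cls (ev const (Poly cs) p) = \<zero>\<^bsub>R\<^esub>"
    using combine_powers[OF p, of cs 0] Ks(2) len by (simp add: Ks_eq Us_def del: upt_Suc)
  then have "ev const (Poly cs) p \<in> I"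
    using p by (simp add: cls_eq_0_iff ev_closed)
  moreover have "Poly cs \<noteq> 0"
  proof
    assume "Poly cs = 0"
    then have "set cs \<subseteq> {0}"
      by (auto simp: Poly_eq_0)
    then have "set Ks \<subseteq> {\<zero>\<^bsub>R\<^esub>}"
      by (auto simp: Ks_eq cls_zero)
    moreover have "Ks \<noteq> []"
      using len by (auto simp: cs_def)
    ultimately show False
      using Ks(4) by (metis set_empty subset_singletonD)
  qed
  ultimately show ?thesis
    by blast
qed

lemma subalgebra_cls:
  assumes "W \<subseteq> polys n" "0 \<in> W"
    and linear: "\<And>c d p q. p \<in> W \<Longrightarrow> q \<in> W \<Longrightarrow> const c * p + const d * q \<in> W"
  shows "subalgebra (scalar n ring_of_type_algebra I0 ` carrier ring_of_type_algebra) (cls ` W) R"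
proof (intro subalgebra.intro subalgebra_axioms.intro)
  show "subgroup (cls ` W) (add_monoid R)"
  proof (rule R.add.subgroupI)
    show "\<ominus>\<^bsub>R\<^esub> a \<in> cls ` W" if a: "a \<in> cls ` W" for a
    proof -
      obtain p where p: "p \<in> W" "a = cls p"
        using a by blast
      have "- p \<in> W"
        using linear[OF p(1) p(1), of "- 1" 0] by (simp add: C_minus_1)
      then show ?thesis
        using p assms(1) by (auto simp: cls_uminus)
    qed
    show "a \<oplus>\<^bsub>R\<^esub> b \<in> cls ` W" if ab: "a \<in> cls ` W" "b \<in> cls ` W" for a b
    proof -
      obtain p q where pq: "p \<in> W" "a = cls p" "q \<in> W" "b = cls q"
        using ab by blast
      have "p + q \<in> W"
        using linear[OF pq(1,3), of 1 1] by simp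
      then show ?thesis
        using pq assms(1) by (simp add: cls_add subset_iff)
    qed
  qed (use assms(1,2) in \<open>auto intro: cls_closed\<close>)
  show "k \<otimes>\<^bsub>R\<^esub> v \<in> cls ` W"
    if kv: "k \<in> scalar n ring_of_type_algebra I0 ` carrier ring_of_type_algebra" "v \<in> cls ` W" for k v
  proof -
    obtain c p where p: "k = cls (const c)" "p \<in> W" "v = cls p"
      using kv by (auto simp: scalar_eq_cls)
    have "const c * p \<in> W"
      using linear[OF p(2) p(2), of c 0] by simp
    then show ?thesis
      using p assms(1) by (auto simp: cls_mult C_closed)
  qed
qed

end

section \<open>The decomposition\<close>

theorem proposition3p11:
  fixes n :: nat
    and K :: "'k::field ring"
    and I :: "(nat multiset \<Rightarrow> 'k) set"
    and R :: "(nat multiset \<Rightarrow> 'k) set ring"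
  defines "K \<equiv> ring_of_type_algebra"
    and "R \<equiv> affine_algebra n K I"
  assumes "ideal I (mpoly_ring n K)"
    and "zero_dimensional n K I"
    and "quasi_perfect_field TYPE('k alg_closure) n K I K id"
  shows "(\<forall>a \<in> carrier R. \<exists>!(b, r). b \<in> separable_elements n I \<and> r \<in> zero_radical R \<and> a = b \<oplus>\<^bsub>R\<^esub> r) \<and>
    (subalgebra (scalar n K I ` carrier K) (separable_elements n I) R \<and>
     subalgebra (scalar n K I ` carrier K) (zero_radical R) R \<and>
     carrier R = separable_elements n I <+>\<^bsub>R\<^esub> zero_radical R \<and>
     separable_elements n I \<inter> zero_radical R = {\<zero>\<^bsub>R\<^esub>})"
proof -
  interpret A: affine_quotient n I
    using assms(3) unfolding K_def by (rule affine_quotient.intro)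
  \<comment> \<open>representatives of the zero radical and of the separable elements\<close>
  define J where "J = {p \<in> polys n. \<exists>k. p ^ k \<in> A.I}"
  define W where "W = {p \<in> polys n. \<exists>g. separable_poly g \<and> ev const g p \<in> A.I}"
  have R: "R = A.R"
    by (simp add: R_def K_def)
  have algebraic: "\<exists>f. f \<noteq> 0 \<and> ev const f p \<in> A.I" if "p \<in> polys n" for p
    using A.zero_dimensional_algebraic assms(4) that by (simp add: K_def)
  have sep: "separable_elements n I = A.cls ` W"
    unfolding W_def using algebraic by (rule A.separable_elements_eq)
  have rad: "zero_radical R = A.cls ` J"
    unfolding J_def R using algebraic by (rule A.zero_radical_eq)
  have J_eq: "J = {p \<in> polys n. \<exists>k. Poly_Mapping.lookup (p ^ k) \<in> I}"
    by (simp add: J_def A.I_def)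
  obtain E where E: "poly_ideal n J" "poly_ideal n E" "extend ` J \<subseteq> E" "E \<subseteq> base_change n J"
    "\<And>x k. x \<in> polys n \<Longrightarrow> x ^ k \<in> E \<Longrightarrow> x \<in> E"
    by (rule quasi_perfect_field_radical_over_closure[OF assms(3)[unfolded K_def] assms(5)[unfolded K_def],
          folded J_eq]) (rule that)
  interpret J: poly_ideal n J
    by (rule E(1))
  have "W \<subseteq> polys n"
    by (auto simp: W_def)
  have linear: "const c * p + const d * q \<in> W" if pq: "p \<in> W" "q \<in> W" for c d p q
  proof -
    have closed: "const c * p + const d * q \<in> polys n"
      using pq \<open>W \<subseteq> polys n\<close> by (intro A.P_add A.P_mult A.C_closed) auto
    obtain f where f: "f \<noteq> 0" "ev const f (const c * p + const d * q) \<in> A.I"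
      using algebraic[OF closed] by blast
    obtain g h where gh: "separable_poly g" "ev const g p \<in> A.I" "separable_poly h" "ev const h q \<in> A.I"
      using pq by (auto simp: W_def)
    have "p \<in> polys n" "q \<in> polys n"
      using pq \<open>W \<subseteq> polys n\<close> by auto
    then obtain e where "separable_poly e" "ev const e (const c * p + const d * q) \<in> A.I"
      using A.separable_linear_combination[OF _ gh(1,2) _ gh(3,4) f(2,1)] by metis
    then show ?thesis
      using closed by (auto simp: W_def)
  qed
  have "separable_poly ([:0, 1:] :: 'k poly)"
    by (auto simp: separable_poly_def map_poly_pCons intro!: exI[of _ 1] exI[of _ "{0}"])
  moreover have "ev const [:0, 1 :: 'k:] 0 \<in> A.I"
    using A.I_zero by (simp add: A.ev_pCons A.ev_0)
  ultimately have "0 \<in> W"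
    using A.P_zero unfolding W_def by blast
  have W_subalgebra: "subalgebra (scalar n K I ` carrier K) (A.cls ` W) R"
    unfolding R K_def using \<open>W \<subseteq> polys n\<close> \<open>0 \<in> W\<close> linear by (rule A.subalgebra_cls)
  have J_subalgebra: "subalgebra (scalar n K I ` carrier K) (A.cls ` J) R"
    unfolding R K_def
    by (rule A.subalgebra_cls) (auto simp: J.I_zero intro!: J.I_add J.I_mult A.C_closed dest: subsetD[OF J.I_subset])
  have disjoint: "p \<in> A.I" if "p \<in> W" "p \<in> J" for p
    using that A.separable_nilpotent_in_ideal unfolding W_def J_def by blast
  have decomposition: "\<exists>q\<in>W. p - q \<in> J" if p: "p \<in> polys n" for p
  proof -
    obtain f where f: "f \<noteq> 0" "ev const f p \<in> A.I"
      using algebraic[OF p] by blast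
    have "A.I \<subseteq> J"
      using A.I_subset unfolding J_def by (auto intro: exI[of _ 1])
    then obtain m where m: "lead_coeff m = 1" "\<And>g. ev const g p \<in> J \<longleftrightarrow> m dvd g"
      using J.minimal_polynomial_exists[OF p, of f] f by blast
    have "separable_poly m"
      by (rule J.separable_minimal_polynomial[OF m p E(2-5)])
    moreover obtain k where "ev const m p ^ k \<in> A.I"
      using m(2)[of m] by (auto simp: J_def)
    ultimately obtain q where q: "q \<in> polys n" "ev const m q \<in> A.I" "(p - q) ^ k \<in> A.I"
      using A.separable_lift[OF p] by blast
    have "q \<in> W"
      using q(1,2) \<open>separable_poly m\<close> unfolding W_def by blast
    moreover have "p - q \<in> J"
      using q(1,3) p unfolding J_def by (blast intro: A.P_diff)
    ultimately show ?thesis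
      by blast
  qed
  have unique: "A.cls p = A.cls q" if pq: "p \<in> W" "q \<in> W" "p - q \<in> J" for p q
  proof -
    have "p - q \<in> W"
      using linear[OF pq(1,2), of 1 "- 1"] by (simp add: A.C_minus_1)
    then have "p - q \<in> A.I"
      using pq(3) by (rule disjoint)
    then show ?thesis
      using pq(1,2) \<open>W \<subseteq> polys n\<close> A.cls_eq_iff[of p q] by blast
  qed
  have cls_plus: "A.cls p \<oplus>\<^bsub>R\<^esub> A.cls q = A.cls (p + q)" if "p \<in> W" "q \<in> J" for p q
    unfolding R using that \<open>W \<subseteq> polys n\<close> J.I_subset by (intro A.cls_add) auto
  have exists: "\<exists>p\<in>W. \<exists>q\<in>J. a = A.cls p \<oplus>\<^bsub>R\<^esub> A.cls q" if a: "a \<in> carrier R" for a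
  proof -
    obtain p where p: "p \<in> polys n" "a = A.cls p"
      using a by (auto simp: R A.carrier_R)
    obtain q where q: "q \<in> W" "p - q \<in> J"
      using decomposition[OF p(1)] by blast
    then have "a = A.cls q \<oplus>\<^bsub>R\<^esub> A.cls (p - q)"
      by (simp add: cls_plus p(2))
    with q show ?thesis
      by blast
  qed
  have same: "A.cls p = A.cls p' \<and> A.cls q = A.cls q'"
    if "p \<in> W" "q \<in> J" "p' \<in> W" "q' \<in> J" and eq: "A.cls p \<oplus>\<^bsub>R\<^esub> A.cls q = A.cls p' \<oplus>\<^bsub>R\<^esub> A.cls q'"
    for p q p' q'
  proof -
    have closed: "p \<in> polys n" "q \<in> polys n" "p' \<in> polys n" "q' \<in> polys n"
      using that \<open>W \<subseteq> polys n\<close> J.I_subset by auto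
    have "(p + q) - (p' + q') \<in> A.I"
      using eq that closed by (simp add: cls_plus A.cls_eq_iff A.P_add)
    then have "(p + q) - (p' + q') \<in> J"
      using A.I_subset unfolding J_def by (auto intro: exI[of _ 1])
    then have "((p + q) - (p' + q')) + (q' - q) \<in> J"
      by (rule J.I_add[OF _ J.I_diff[OF that(4,2)]])
    then have cls_p: "A.cls p = A.cls p'"
      using that by (intro unique) (simp_all add: algebra_simps)
    then have "A.cls p \<oplus>\<^bsub>R\<^esub> A.cls q = A.cls p \<oplus>\<^bsub>R\<^esub> A.cls q'"
      using eq by simp
    then have "A.cls (p + q) = A.cls (p + q')"
      using that(1,2,4) by (simp only: cls_plus)
    then have "A.cls q = A.cls q'"
      using closed by (simp add: A.cls_eq_iff A.P_add)
    with cls_p show ?thesis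
      by blast
  qed
  have unique_decomposition: "\<exists>!(b, r). b \<in> A.cls ` W \<and> r \<in> A.cls ` J \<and> a = b \<oplus>\<^bsub>R\<^esub> r"
    if a: "a \<in> carrier R" for a
  proof -
    obtain p q where pq: "p \<in> W" "q \<in> J" "a = A.cls p \<oplus>\<^bsub>R\<^esub> A.cls q"
      using exists[OF a] by blast
    have "x = (A.cls p, A.cls q)"
      if x: "case x of (b, r) \<Rightarrow> b \<in> A.cls ` W \<and> r \<in> A.cls ` J \<and> a = b \<oplus>\<^bsub>R\<^esub> r" for x
    proof -
      obtain p' q' where x': "x = (A.cls p', A.cls q')" "p' \<in> W" "q' \<in> J"
          "a = A.cls p' \<oplus>\<^bsub>R\<^esub> A.cls q'"
        using x by (cases x) blast
      have "A.cls p' \<oplus>\<^bsub>R\<^esub> A.cls q' = A.cls p \<oplus>\<^bsub>R\<^esub> A.cls q"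
        using pq(3) x'(4) by (rule trans[OF sym, rotated])
      then show ?thesis
        using same[OF x'(2,3) pq(1,2)] by (simp only: x'(1))
    qed
    then show ?thesis
      by (intro ex1I[of _ "(A.cls p, A.cls q)"]) (simp_all only: prod.case pq imageI conj_assoc simp_thms)
  qed
  have sum: "carrier R = A.cls ` W <+>\<^bsub>R\<^esub> A.cls ` J"
  proof -
    have "A.cls p \<oplus>\<^bsub>R\<^esub> A.cls q \<in> carrier R" if "p \<in> W" "q \<in> J" for p q
      unfolding R using that \<open>W \<subseteq> polys n\<close> J.I_subset by (intro A.R.a_closed A.cls_closed) auto
    then show ?thesis
      using exists unfolding set_add_def' by fast
  qed
  have intersection: "A.cls ` W \<inter> A.cls ` J = {\<zero>\<^bsub>R\<^esub>}"
  proof -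
    have zero: "\<zero>\<^bsub>R\<^esub> = A.cls 0"
      by (simp add: R A.cls_zero)
    have "A.cls p = \<zero>\<^bsub>R\<^esub>" if pq: "p \<in> W" "q \<in> J" "A.cls p = A.cls q" for p q
    proof -
      have "A.cls p \<oplus>\<^bsub>R\<^esub> A.cls 0 = A.cls 0 \<oplus>\<^bsub>R\<^esub> A.cls q"
        unfolding cls_plus[OF pq(1) J.I_zero] cls_plus[OF \<open>0 \<in> W\<close> pq(2)] using pq(3) by simp
      then show ?thesis
        unfolding zero by (rule conjunct1[OF same[OF pq(1) J.I_zero \<open>0 \<in> W\<close> pq(2)]])
    qed
    then have "A.cls ` W \<inter> A.cls ` J \<subseteq> {\<zero>\<^bsub>R\<^esub>}"
      by blast
    moreover have "\<zero>\<^bsub>R\<^esub> \<in> A.cls ` W \<inter> A.cls ` J"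
      unfolding zero using \<open>0 \<in> W\<close> J.I_zero by blast
    ultimately show ?thesis
      by blast
  qed
  show ?thesis
    unfolding sep rad
    by (intro conjI ballI unique_decomposition W_subalgebra J_subalgebra sum intersection)
qed

end
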